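(* Mean Shift is consistent, in the following sense. Let $x_*$ be a mode of $f$ and let $x_0$ be a point with $f(x_0)>0$ in the basin of attraction of $x_*$. Then there are $h_0>0$ and, for each $h\in(0,h_0]$, a mode $x_{h,*}$ of $f^L_h$, such that $x_{h,*}\to x_*$ as $h\to0$ and, for all $h\in(0,h_0]$, the Mean Shift sequence with bandwidth $h$ initialized at $x_0$ converges to $x_{h,*}$.
   Context: Density. $f$ is a probability density on $\mathbb{R}^d$ with respect to Lebesgue measure such that: (i) $f(x)\to0$ as $\|x\|\to\infty$; (ii) $f$ is twice differentiable everywhere, and $f$, $\nabla f$, $\nabla^2 f$ are bounded and uniformly continuous; (iii) the Hessian $\nabla^2 f$ is non-singular at every critical point of $f$. A mode of a function is a local maximum of it. Gradient flow. For $x\in\mathbb{R}^d$, $\gamma_x:[0,\infty)\to\mathbb{R}^d$ is the solution of $\gamma_x(0)=x$, $\dot\gamma_x(t)=\nabla f(\gamma_x(t))$; $\gamma_x(t)$ converges to a critical point of $f$ as $t\to\infty$, denoted $\gamma_x(\infty)$. The basin of attraction of $x_*$ is $\{x:\gamma_x(\infty)=x_*\}$. Kernels. $K(x)=k(\|x\|^2)$ is a kernel ($\int K=1$) for some nonnegative, nonincreasing, integrable function $k$ on $[0,\infty)$, and $L(x)=\ell(\|x\|^2)$ with $\ell(u)=c\int_u^\infty k(v)\,dv$; it is assumed that $k$ decays fast enough that, for a suitable constant $c>0$, $L$ is also a kernel ($\int L=1$). For $h>0$, $K_h=h^{-d}K(\cdot/h)$, $L_h=h^{-d}L(\cdot/h)$,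 and $f^L_h=L_h*f$. Mean Shift. For $h>0$ the mean shift at $x$ is $$\mathrm{MS}_h(x)=\frac{\int K_h(y-x)(y-x)f(y)\,dy}{\int K_h(y-x)f(y)\,dy},$$ and the Mean Shift algorithm initialized at $x_0$ produces $x(0)=x_0$, $x(k+1)=x(k)+\mathrm{MS}_h(x(k))$, $k\ge0$. *)

theory Defs
  imports "HOL-Analysis.Analysis"
begin

definition grad :: "(real^'n \<Rightarrow> real) \<Rightarrow> real^'n \<Rightarrow> real^'n" where
  "grad f x = (\<chi> i. frechet_derivative f (at x) (axis i 1))"

definition hess :: "(real^'n \<Rightarrow> real) \<Rightarrow> real^'n \<Rightarrow> real^'n^'n" where
  "hess f x = jacobian (grad f) (at x)"

(* Local maxima are not required to be strict. *)
definition is_mode :: "(real^'n \<Rightarrow> real) \<Rightarrow> real^'n \<Rightarrow> bool" where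
  "is_mode f x \<longleftrightarrow> (\<forall>\<^sub>F y in nhds x. f y \<le> f x)"

definition is_gradient_flow_line ::
  "(real^'n \<Rightarrow> real) \<Rightarrow> real^'n \<Rightarrow> (real \<Rightarrow> real^'n) \<Rightarrow> bool" where
  "is_gradient_flow_line f x \<gamma> \<longleftrightarrow> \<gamma> 0 = x \<and>
     (\<forall>t\<ge>0. (\<gamma> has_vector_derivative grad f (\<gamma> t)) (at t within {0..}))"

(* When grad f is Lipschitz, the flow line from x is unique on {0..}, so the existential
   quantifier picks out that one trajectory. *)
definition basin :: "(real^'n \<Rightarrow> real) \<Rightarrow> real^'n \<Rightarrow> (real^'n) set" where
  "basin f xs = {x. \<exists>\<gamma>. is_gradient_flow_line f x \<gamma> \<and> (\<gamma> \<longlongrightarrow> xs) at_top}"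

definition radial :: "(real \<Rightarrow> real) \<Rightarrow> real^'n \<Rightarrow> real" where
  "radial k x = k ((norm x)\<^sup>2)"

definition shadow_profile :: "(real \<Rightarrow> real) \<Rightarrow> real \<Rightarrow> real \<Rightarrow> real" where
  "shadow_profile k c u = c * (LINT v:{u..}|lborel. k v)"

definition rescale :: "real \<Rightarrow> (real^'n \<Rightarrow> real) \<Rightarrow> real^'n \<Rightarrow> real" where
  "rescale h K x = K (x /\<^sub>R h) / h ^ CARD('n)"

definition convolve :: "(real^'n \<Rightarrow> real) \<Rightarrow> (real^'n \<Rightarrow> real) \<Rightarrow> real^'n \<Rightarrow> real" where
  "convolve g f x = (LINT y|lborel. g (x - y) * f y)"

(* If the denominator vanishes, this evaluates to 0 and x becomes a fixed point of the iteration.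
   This cannot happen at a limit point near which f is positive. *)
definition mean_shift ::
  "(real^'n \<Rightarrow> real) \<Rightarrow> (real^'n \<Rightarrow> real) \<Rightarrow> real \<Rightarrow> real^'n \<Rightarrow> real^'n" where
  "mean_shift K f h x =
     (LINT y|lborel. (rescale h K (y - x) * f y) *\<^sub>R (y - x)) /\<^sub>R
     (LINT y|lborel. rescale h K (y - x) * f y)"

primrec mean_shift_seq ::
  "(real^'n \<Rightarrow> real) \<Rightarrow> (real^'n \<Rightarrow> real) \<Rightarrow> real \<Rightarrow> real^'n \<Rightarrow> nat \<Rightarrow> real^'n" where
  "mean_shift_seq K f h x0 0 = x0"
| "mean_shift_seq K f h x0 (Suc j) =
     mean_shift_seq K f h x0 j + mean_shift K f h (mean_shift_seq K f h x0 j)"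

end

theory Submission
  imports Defs
begin

text \<open>
  Write \<open>f\<^sub>h\<close> for the average of \<open>f\<close> against the shadow kernel \<open>L\<close> at bandwidth \<open>h\<close>, \<open>p\<^sub>h\<close> for
  the average against \<open>K\<close>, and \<open>G\<^sub>h\<close> for the average of the gradient of \<open>f\<close> against \<open>L\<close>. The
  theorem rests on the fact that a Mean Shift step is a gradient ascent step for \<open>f\<^sub>h\<close>,
  \<open>MS\<^sub>h(x) = h\<^sup>2 / (2 c p\<^sub>h(x)) G\<^sub>h(x)\<close>, with a step size of order \<open>h\<^sup>2\<close> wherever \<open>f\<close> is bounded
  away from zero (\<open>mean_shift_is_gradient_step\<close>). As \<open>k\<close> may jump, \<open>L\<close> need not be
  differentiable, so the identity is not obtained by differentiating under the integral.
  Instead, the profile of \<open>L\<close> is convex with slope \<open>-c k\<close>, and its tangent inequality bounds the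
  increments of \<open>f\<^sub>h\<close> below by a linear form given by the Mean Shift numerator, up to a quadratic
  error; Taylor expansion of \<open>f\<close> bounds them above by \<open>G\<^sub>h\<close>, again up to a quadratic error. Two
  linear forms that compare in this way are equal.

  The rest is dynamics. All kernel averages are uniformly close to the averaged functions as
  \<open>h\<close> tends to 0 (\<open>kernel_avg_approx\<close>), so the iteration is a perturbed Euler scheme for the
  gradient flow, with variable steps that tend to 0 uniformly but are bounded below for each
  fixed \<open>h\<close>. Along the flow line \<open>f\<close> is at least \<open>f x0 > 0\<close>, which keeps the step sizes under
  control, and a Gronwall estimate shows that the iterates follow the flow line up to a time at
  which it is close to the mode (\<open>euler_shadows_flow\<close>).

  Near the mode the Hessian is negative definite, because it is symmetric, negative
  semidefinite and nonsingular; thus the gradient of \<open>f\<close> is strongly monotone there. This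
  property passes to \<open>G\<^sub>h\<close>, since only a small part of the mass of the rescaled kernel lies far
  from the origin (\<open>kernel_avg_strongly_monotone\<close>). Consequently \<open>f\<^sub>h\<close> has a critical point close
  to the mode that is a local maximum
  (\<open>interior_max_of_strongly_monotone_gradient\<close>), and gradient ascent with small steps contracts
  towards it (\<open>gradient_ascent_converges\<close>). No derivative of \<open>G\<^sub>h\<close> is ever taken.
\<close>

section \<open>Gradients, Hessians and nondegenerate maxima\<close>

lemma mvt_gradient:
  fixes g :: "'a::real_inner \<Rightarrow> real"
  assumes der: "\<And>t. 0 \<le> t \<Longrightarrow> t \<le> 1 \<Longrightarrow>
      (g has_derivative (\<lambda>v. G (x + t *\<^sub>R w) \<bullet> v)) (at (x + t *\<^sub>R w))"
  obtains t where "0 < t" "t < 1" "g (x + w) - g x = G (x + t *\<^sub>R w) \<bullet> w"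
proof -
  have d: "((\<lambda>t. g (x + t *\<^sub>R w)) has_real_derivative G (x + t *\<^sub>R w) \<bullet> w) (at t)"
    if "0 \<le> t" "t \<le> 1" for t
  proof -
    have "((\<lambda>t. x + t *\<^sub>R w) has_derivative (\<lambda>s. s *\<^sub>R w)) (at t)"
      by (auto intro!: derivative_eq_intros)
    from diff_chain_at[OF this der[OF that]] show ?thesis
      by (simp add: has_field_derivative_def o_def mult.commute[of _ "_ \<bullet> w"])
  qed
  from MVT2[of 0 1 "\<lambda>t. g (x + t *\<^sub>R w)" "\<lambda>t. G (x + t *\<^sub>R w) \<bullet> w"] d
  show thesis using that by auto
qed

lemma gradient_linear_approx:
  fixes g :: "'a::real_inner \<Rightarrow> real"
  assumes der: "\<And>x. (g has_derivative (\<lambda>v. G x \<bullet> v)) (at x)"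
    and lip: "M-lipschitz_on UNIV G"
  shows "\<bar>g (x + w) - g x - G x \<bullet> w\<bar> \<le> M * (norm w)\<^sup>2"
proof -
  obtain t where t: "0 < t" "t < 1" "g (x + w) - g x = G (x + t *\<^sub>R w) \<bullet> w"
    using mvt_gradient[of g G x w] der by blast
  have M: "0 \<le> M" using lip by (rule lipschitz_on_nonneg)
  have "g (x + w) - g x - G x \<bullet> w = (G (x + t *\<^sub>R w) - G x) \<bullet> w"
    using t by (simp add: inner_diff_left)
  also have "\<bar>\<dots>\<bar> \<le> norm (G (x + t *\<^sub>R w) - G x) * norm w"
    by (rule Cauchy_Schwarz_ineq2)
  also have "\<dots> \<le> (M * norm (x + t *\<^sub>R w - x)) * norm w"
    using lipschitz_on_normD[OF lip, of "x + t *\<^sub>R w" x] by (intro mult_right_mono) auto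
  also have "\<dots> \<le> (M * norm w) * norm w"
    using t M by (intro mult_right_mono mult_left_mono) (auto simp: mult_left_le_one_le)
  finally show ?thesis by (simp add: power2_eq_square)
qed

text \<open>Used to see that \<open>G\<^sub>h\<close> is the gradient of \<open>f\<^sub>h\<close>: the quadratic error bound of \<open>f\<close> survives
  averaging, so there is no need to differentiate under the integral.\<close>

lemma has_derivative_from_linear_approx:
  fixes g :: "'a::real_inner \<Rightarrow> real"
  assumes approx: "\<And>w. \<bar>g (x + w) - g x - a \<bullet> w\<bar> \<le> M * (norm w)\<^sup>2"
  shows "(g has_derivative (\<lambda>v. a \<bullet> v)) (at x)"
  unfolding has_derivative_at_alt
proof (intro conjI allI impI bounded_linear_inner_right)
  fix e :: real assume e: "0 < e"
  define d where "d = e / (\<bar>M\<bar> + 1)"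
  have d: "0 < d" using e by (simp add: d_def)
  moreover have "norm (g y - g x - a \<bullet> (y - x)) \<le> e * norm (y - x)" if "norm (y - x) < d" for y
  proof -
    have "norm (g y - g x - a \<bullet> (y - x)) \<le> M * (norm (y - x))\<^sup>2"
      using approx[of "y - x"] by simp
    also have "\<dots> \<le> (\<bar>M\<bar> + 1) * (norm (y - x))\<^sup>2"
      by (intro mult_right_mono) auto
    also have "\<dots> \<le> (\<bar>M\<bar> + 1) * (d * norm (y - x))"
      unfolding power2_eq_square using that by (intro mult_left_mono mult_right_mono) auto
    also have "\<dots> = e * norm (y - x)" by (simp add: d_def)
    finally show ?thesis .
  qed
  ultimately show "\<exists>d>0. \<forall>y. norm (y - x) < d \<longrightarrow>
      norm (g y - g x - a \<bullet> (y - x)) \<le> e * norm (y - x)" by blast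
qed

text \<open>For small \<open>w\<close> in the direction of \<open>a\<close> the quadratic right-hand side loses against the linear
  left-hand side. In this form, one-sided bounds suffice to identify two linear forms.\<close>

lemma inner_zero_from_quadratic_bound:
  fixes a :: "'a::real_inner"
  assumes "\<And>w. a \<bullet> w \<le> C * (norm w)\<^sup>2"
  shows "a = 0"
proof (rule ccontr)
  assume "a \<noteq> 0"
  define t where "t = 1 / (\<bar>C\<bar> + 1)"
  have t: "0 < t" by (simp add: t_def)
  have "a \<bullet> (t *\<^sub>R a) \<le> C * (norm (t *\<^sub>R a))\<^sup>2" by (rule assms)
  hence "t * (norm a)\<^sup>2 \<le> C * t\<^sup>2 * (norm a)\<^sup>2"
    by (simp add: power_mult_distrib dot_square_norm)
  hence "t \<le> C * t\<^sup>2" using \<open>a \<noteq> 0\<close> by simp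
  hence "1 \<le> C * t" using t by (simp add: power2_eq_square)
  also have "C * t < 1" by (simp add: t_def field_simps)
  finally show False by simp
qed

lemma has_derivative_grad:
  fixes f :: "real^'n \<Rightarrow> real"
  assumes "f differentiable (at x)"
  shows "(f has_derivative (\<lambda>v. grad f x \<bullet> v)) (at x)"
proof -
  let ?D = "frechet_derivative f (at x)"
  have D: "(f has_derivative ?D) (at x)"
    using assms by (simp add: frechet_derivative_works)
  then interpret linear ?D by (rule has_derivative_linear)
  have "?D v = grad f x \<bullet> v" for v
  proof -
    have "?D v = ?D (\<Sum>i\<in>UNIV. v $ i *\<^sub>R axis i 1)"
      using basis_expansion[of v] by (simp add: scalar_mult_eq_scaleR)
    also have "\<dots> = (\<Sum>i\<in>UNIV. v $ i *\<^sub>R ?D (axis i 1))"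
      by (simp add: sum scale)
    finally show ?thesis by (simp add: grad_def inner_vec_def mult.commute)
  qed
  hence "?D = (\<lambda>v. grad f x \<bullet> v)" by blast
  thus ?thesis using D by simp
qed

lemma has_derivative_hess:
  fixes f :: "real^'n \<Rightarrow> real"
  assumes "grad f differentiable (at x)"
  shows "(grad f has_derivative (\<lambda>v. hess f x *v v)) (at x)"
  using assms by (simp add: hess_def jacobian_works)

lemma norm_matrix_vector_mult_le:
  fixes A :: "real^'n^'n"
  shows "norm (A *v v) \<le> real (CARD('n)) * real (CARD('n)) * norm A * norm v"
proof -
  have "\<bar>A $ i $ j\<bar> \<le> norm A" for i j
    by (metis Finite_Cartesian_Product.norm_nth_le component_le_norm_cart order_trans)
  hence "onorm ((*v) A) \<le> real (CARD('n)) * real (CARD('n)) * norm A"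
    by (intro onorm_le_matrix_component)
  moreover have "norm (A *v v) \<le> onorm ((*v) A) * norm v"
    by (intro onorm matrix_vector_mul_bounded_linear)
  ultimately show ?thesis
    by (meson mult_right_mono norm_ge_zero order_trans)
qed

lemma lipschitz_from_bounded_derivative:
  fixes G :: "'a::real_normed_vector \<Rightarrow> 'b::real_normed_vector"
  assumes der: "\<And>x. (G has_derivative G' x) (at x)"
    and bound: "\<And>x v. norm (G' x v) \<le> B * norm v" and "0 \<le> B"
  shows "B-lipschitz_on UNIV G"
proof (rule lipschitz_onI)
  fix x y
  have "onorm (G' z) \<le> B" for z using \<open>0 \<le> B\<close> bound by (rule onorm_bound)
  hence "norm (G x - G y) \<le> B * norm (x - y)"
    using der by (intro differentiable_bound[of UNIV G G']) auto
  thus "dist (G x) (G y) \<le> B * dist x y" by (simp add: dist_norm)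
qed fact

lemma lipschitz_grad:
  fixes f :: "real^'n \<Rightarrow> real"
  assumes "\<And>x. grad f differentiable (at x)" "bounded (range (hess f))"
  obtains M where "0 < M" "M-lipschitz_on UNIV (grad f)"
proof -
  obtain b where b: "\<And>x. norm (hess f x) \<le> b" "0 < b"
    using assms(2) unfolding bounded_pos by auto
  let ?M = "real (CARD('n)) * real (CARD('n)) * b"
  have "?M-lipschitz_on UNIV (grad f)"
  proof (rule lipschitz_from_bounded_derivative)
    show "(grad f has_derivative (\<lambda>v. hess f x *v v)) (at x)" for x
      using assms(1) by (rule has_derivative_hess)
    show "norm (hess f x *v v) \<le> ?M * norm v" for x v
      by (rule order_trans[OF norm_matrix_vector_mult_le])
        (use b in \<open>auto intro!: mult_right_mono mult_left_mono\<close>)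
  qed (use b in auto)
  moreover have "0 < ?M" using b by simp
  ultimately show thesis using that by blast
qed

lemma lipschitz_from_bounded_grad:
  fixes f :: "real^'n \<Rightarrow> real"
  assumes "\<And>x. f differentiable (at x)" and B: "\<And>x. norm (grad f x) \<le> B"
  shows "B-lipschitz_on UNIV f"
proof (rule lipschitz_from_bounded_derivative)
  show "(f has_derivative (\<lambda>v. grad f x \<bullet> v)) (at x)" for x
    using assms(1) by (rule has_derivative_grad)
  show "norm (grad f x \<bullet> v) \<le> B * norm v" for x v
    using Cauchy_Schwarz_ineq2[of "grad f x" v] mult_right_mono[OF B[of x], of "norm v"] by simp
  show "0 \<le> B" using B[of 0] norm_ge_zero order_trans by blast
qed

text \<open>Apply the mean value theorem to \<open>p \<mapsto> f (p + t v) - f p\<close> in the direction \<open>u\<close>, then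
  expand the gradient to first order at \<open>x\<close>. The second difference is symmetric in \<open>u\<close> and \<open>v\<close>,
  which is what makes the second derivative symmetric.\<close>

lemma second_difference_estimate:
  fixes f :: "'a::real_inner \<Rightarrow> real"
  assumes der: "\<And>x. (f has_derivative (\<lambda>v. G x \<bullet> v)) (at x)"
    and H: "linear H"
    and near: "\<And>w. norm w < d \<Longrightarrow> norm (G (x + w) - G x - H w) \<le> e * norm w"
    and "0 \<le> e" "0 < t" and small: "t * (norm u + norm v) < d"
  shows "\<bar>(f (x + t *\<^sub>R u + t *\<^sub>R v) - f (x + t *\<^sub>R u) - f (x + t *\<^sub>R v) + f x) - t\<^sup>2 * (H v \<bullet> u)\<bar>
    \<le> 2 * e * t\<^sup>2 * (norm u + norm v) * norm u"
proof -
  interpret linear H by fact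
  let ?g = "\<lambda>p. f (p + t *\<^sub>R v) - f p"
  let ?G = "\<lambda>p. G (p + t *\<^sub>R v) - G p"
  have "(?g has_derivative (\<lambda>w. ?G p \<bullet> w)) (at p)" for p
  proof -
    have "((\<lambda>p. p + t *\<^sub>R v) has_derivative (\<lambda>w. w)) (at p)"
      by (auto intro!: derivative_eq_intros)
    from diff_chain_at[OF this der] have "((\<lambda>p. f (p + t *\<^sub>R v)) has_derivative
        (\<lambda>w. G (p + t *\<^sub>R v) \<bullet> w)) (at p)" by (simp add: o_def)
    from has_derivative_diff[OF this der] show ?thesis by (simp add: inner_diff_left)
  qed
  then obtain s where s: "0 < s" "s < 1"
    and eq: "?g (x + t *\<^sub>R u) - ?g x = ?G (x + s *\<^sub>R (t *\<^sub>R u)) \<bullet> (t *\<^sub>R u)"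
    using mvt_gradient[of ?g ?G x "t *\<^sub>R u"] by blast
  let ?p = "s *\<^sub>R (t *\<^sub>R u)" and ?q = "s *\<^sub>R (t *\<^sub>R u) + t *\<^sub>R v"
  have n1: "norm ?p \<le> t * (norm u + norm v)"
  proof -
    have "norm ?p = s * (t * norm u)" using s \<open>0 < t\<close> by simp
    also have "\<dots> \<le> t * norm u" using s \<open>0 < t\<close> by (simp add: mult_left_le_one_le)
    finally show ?thesis using \<open>0 < t\<close> by (simp add: distrib_left add_increasing2)
  qed
  have n2: "norm ?q \<le> t * (norm u + norm v)"
  proof -
    have "norm ?q \<le> norm ?p + norm (t *\<^sub>R v)" by (rule norm_triangle_ineq)
    also have "norm ?p = s * (t * norm u)" using s \<open>0 < t\<close> by simp
    also have "\<dots> \<le> t * norm u" using s \<open>0 < t\<close> by (simp add: mult_left_le_one_le)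
    finally show ?thesis using \<open>0 < t\<close> by (simp add: distrib_left)
  qed
  define r1 where "r1 = G (x + ?p) - G x - H ?p"
  define r2 where "r2 = G (x + ?q) - G x - H ?q"
  have r1: "norm r1 \<le> e * (t * (norm u + norm v))"
    unfolding r1_def by (rule order_trans[OF near]) (use n1 small \<open>0 \<le> e\<close> in \<open>auto intro: mult_left_mono\<close>)
  have r2: "norm r2 \<le> e * (t * (norm u + norm v))"
    unfolding r2_def by (rule order_trans[OF near]) (use n2 small \<open>0 \<le> e\<close> in \<open>auto intro: mult_left_mono\<close>)
  have "?G (x + ?p) = t *\<^sub>R H v + (r2 - r1)"
    unfolding r1_def r2_def by (simp add: add scale algebra_simps)
  hence "(?g (x + t *\<^sub>R u) - ?g x) - t\<^sup>2 * (H v \<bullet> u) = t * ((r2 - r1) \<bullet> u)"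
    unfolding eq inner_scaleR_right by (simp add: inner_add_left power2_eq_square distrib_left)
  hence "\<bar>(?g (x + t *\<^sub>R u) - ?g x) - t\<^sup>2 * (H v \<bullet> u)\<bar> = t * \<bar>(r2 - r1) \<bullet> u\<bar>"
    using \<open>0 < t\<close> by (simp add: abs_mult)
  also have "\<dots> \<le> t * ((norm r2 + norm r1) * norm u)"
    using \<open>0 < t\<close> by (intro mult_left_mono order_trans[OF Cauchy_Schwarz_ineq2] mult_right_mono
        norm_triangle_ineq4) auto
  also have "\<dots> \<le> t * ((e * (t * (norm u + norm v)) + e * (t * (norm u + norm v))) * norm u)"
    using \<open>0 < t\<close> r1 r2 by (intro mult_left_mono mult_right_mono add_mono) auto
  finally show ?thesis by (simp add: power2_eq_square algebra_simps)
qed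

lemma second_derivative_symmetric:
  fixes f :: "'a::real_inner \<Rightarrow> real"
  assumes der: "\<And>x. (f has_derivative (\<lambda>v. G x \<bullet> v)) (at x)"
    and H: "(G has_derivative H) (at x)"
  shows "H v \<bullet> u = H u \<bullet> v"
proof -
  define C where "C = 2 * (norm u + norm v) * (norm u + norm v)"
  have C: "0 \<le> C" by (simp add: C_def)
  have est: "\<bar>H v \<bullet> u - H u \<bullet> v\<bar> \<le> e * C" if e: "0 < e" for e
  proof -
    from H e obtain d where "0 < d"
      and d: "\<And>y. norm (y - x) < d \<Longrightarrow> norm (G y - G x - H (y - x)) \<le> e * norm (y - x)"
      unfolding has_derivative_at_alt by blast
    have near: "norm (G (x + w) - G x - H w) \<le> e * norm w" if "norm w < d" for w
      using d[of "x + w"] that by simp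
    define t where "t = d / (norm u + norm v + 1)"
    have t: "0 < t" using \<open>0 < d\<close> by (simp add: t_def add_nonneg_pos)
    have "t * (norm u + norm v) < t * (norm u + norm v + 1)" using t by simp
    also have "\<dots> = d" unfolding t_def by (simp add: add_nonneg_pos less_imp_neq[symmetric])
    finally have small: "t * (norm u + norm v) < d" .
    have lin: "linear H" using H has_derivative_linear by blast
    let ?\<Delta> = "f (x + t *\<^sub>R u + t *\<^sub>R v) - f (x + t *\<^sub>R u) - f (x + t *\<^sub>R v) + f x"
    have "\<bar>?\<Delta> - t\<^sup>2 * (H v \<bullet> u)\<bar> \<le> 2 * e * t\<^sup>2 * (norm u + norm v) * norm u"
      using e by (intro second_difference_estimate[OF der lin near _ t small]) auto
    moreover have "\<bar>?\<Delta> - t\<^sup>2 * (H u \<bullet> v)\<bar> \<le> 2 * e * t\<^sup>2 * (norm u + norm v) * norm v"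
      using e small second_difference_estimate[OF der lin near _ t, where u=v and v=u]
      by (auto simp: algebra_simps)
    ultimately have "\<bar>t\<^sup>2 * (H v \<bullet> u) - t\<^sup>2 * (H u \<bullet> v)\<bar>
        \<le> 2 * e * t\<^sup>2 * (norm u + norm v) * norm u + 2 * e * t\<^sup>2 * (norm u + norm v) * norm v"
      by linarith
    also have "\<dots> = t\<^sup>2 * (e * C)" by (simp add: C_def algebra_simps)
    also have "\<bar>t\<^sup>2 * (H v \<bullet> u) - t\<^sup>2 * (H u \<bullet> v)\<bar> = t\<^sup>2 * \<bar>H v \<bullet> u - H u \<bullet> v\<bar>"
      by (simp add: abs_mult flip: right_diff_distrib)
    finally show ?thesis using t by simp
  qed
  have "\<bar>H v \<bullet> u - H u \<bullet> v\<bar> \<le> 0 + e" if "0 < e" for e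
  proof -
    have "\<bar>H v \<bullet> u - H u \<bullet> v\<bar> \<le> (e / (C + 1)) * C"
      using that C by (intro est) (simp add: add_nonneg_pos)
    also have "\<dots> \<le> e" using that C by (simp add: field_simps)
    finally show ?thesis by simp
  qed
  thus ?thesis using field_le_epsilon[of "\<bar>H v \<bullet> u - H u \<bullet> v\<bar>" 0] by auto
qed

text \<open>If \<open>H w \<bullet> w\<close> were positive, the directional derivative of \<open>f\<close> in the direction \<open>w\<close>, which vanishes at \<open>x\<close>,
  would be positive at all points a little further along, and \<open>f\<close> would increase.\<close>

lemma second_order_necessary:
  fixes f :: "'a::real_inner \<Rightarrow> real"
  assumes der: "\<And>x. (f has_derivative (\<lambda>v. G x \<bullet> v)) (at x)"
    and H: "(G has_derivative H) (at x)"
    and max: "\<forall>\<^sub>F y in nhds x. f y \<le> f x"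
  shows "G x = 0" "H w \<bullet> w \<le> 0"
proof -
  obtain d where d: "0 < d" "\<And>y. dist y x < d \<Longrightarrow> f y \<le> f x"
    using max unfolding eventually_nhds_metric by blast
  have "(\<lambda>v. G x \<bullet> v) = (\<lambda>v. 0)"
    using d by (intro differential_zero_maxmin[OF _ open_ball der, of x x d])
      (auto simp: dist_commute)
  from fun_cong[OF this, of "G x"] show zero: "G x = 0" by simp
  show "H w \<bullet> w \<le> 0"
  proof (rule ccontr)
    assume neg: "\<not> H w \<bullet> w \<le> 0"
    have "((\<lambda>t. x + t *\<^sub>R w) has_derivative (\<lambda>s. s *\<^sub>R w)) (at 0)"
      by (auto intro!: derivative_eq_intros)
    moreover have "(G has_derivative H) (at (x + 0 *\<^sub>R w))" using H by simp
    ultimately have "((\<lambda>t. G (x + t *\<^sub>R w)) has_derivative (\<lambda>s. H (s *\<^sub>R w))) (at 0)"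
      by (auto dest: diff_chain_at simp: o_def)
    moreover have "H (s *\<^sub>R w) = s *\<^sub>R H w" for s
      using has_derivative_linear[OF H] by (rule linear_scale)
    ultimately have "((\<lambda>t. G (x + t *\<^sub>R w) \<bullet> w) has_real_derivative H w \<bullet> w) (at 0)"
      by (auto simp: has_field_derivative_def mult.commute intro!: derivative_eq_intros)
    from DERIV_pos_inc_right[OF this] neg zero obtain e where e: "0 < e"
      and inc: "\<And>t. 0 < t \<Longrightarrow> t < e \<Longrightarrow> 0 < G (x + t *\<^sub>R w) \<bullet> w" by auto
    define t where "t = min (e / 2) (d / (norm w + 1))"
    have t: "0 < t" "t < e" using e d by (auto simp: t_def add_nonneg_pos)
    have "t * norm w < t * (norm w + 1)" using t by simp
    also have "\<dots> \<le> d / (norm w + 1) * (norm w + 1)"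
      unfolding t_def by (intro mult_right_mono) auto
    also have "\<dots> = d" by (simp add: add_nonneg_pos less_imp_neq[symmetric])
    finally have "f (x + t *\<^sub>R w) \<le> f x" using d(2)[of "x + t *\<^sub>R w"] t by (simp add: dist_norm)
    moreover obtain s where s: "0 < s" "s < 1"
      and eq: "f (x + t *\<^sub>R w) - f x = G (x + s *\<^sub>R (t *\<^sub>R w)) \<bullet> (t *\<^sub>R w)"
      using mvt_gradient[of f G x "t *\<^sub>R w"] der by blast
    have "s * t < e" using s t by (meson less_trans mult_less_cancel_right2 zero_less_mult_iff less_imp_le not_less)
    hence "0 < G (x + s *\<^sub>R (t *\<^sub>R w)) \<bullet> (t *\<^sub>R w)"
      using inc[of "s * t"] s t by simp
    ultimately show False using eq by simp
  qed
qed

text \<open>Let \<open>v\<close> maximise the quadratic form on the unit sphere. If the maximum were 0, then by symmetry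
  and semidefiniteness the linear form \<open>w \<mapsto> H v \<bullet> w\<close> would be bounded by a quadratic one, so
  \<open>H v = 0\<close>. Symmetry is essential: a quarter turn of the plane is injective and semidefinite.\<close>

lemma negative_definite_from_semidefinite:
  fixes H :: "'a::euclidean_space \<Rightarrow> 'a"
  assumes H: "linear H" and sym: "\<And>u v. H u \<bullet> v = H v \<bullet> u"
    and semi: "\<And>w. H w \<bullet> w \<le> 0" and inj: "\<And>w. H w = 0 \<Longrightarrow> w = 0"
  obtains m where "0 < m" "\<And>w. H w \<bullet> w \<le> - m * (norm w)\<^sup>2"
proof -
  interpret H: linear H by fact
  have cont: "continuous_on S H" for S using H by (rule linear_continuous_on_compose[OF continuous_on_id, simplified])
  have "continuous_on (sphere 0 1) (\<lambda>w. H w \<bullet> w)" by (intro continuous_intros cont)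
  from continuous_attains_sup[OF compact_sphere _ this] obtain v where v: "v \<in> sphere 0 1" and max: "\<And>w. w \<in> sphere 0 1 \<Longrightarrow> H w \<bullet> w \<le> H v \<bullet> v"
    by auto
  define m where "m = - (H v \<bullet> v)"
  have "H v \<bullet> v \<noteq> 0"
  proof
    assume 0: "H v \<bullet> v = 0"
    obtain B where B: "\<And>w. norm (H w) \<le> B * norm w" using linear_bounded[OF H] by blast
    have "H v \<bullet> w \<le> B / 2 * (norm w)\<^sup>2" for w
    proof -
      have "2 * (H v \<bullet> w) + H w \<bullet> w \<le> 0"
        using semi[of "v + w"] 0 sym[of w v] by (simp add: H.add inner_add_left inner_add_right)
      moreover have "- (H w \<bullet> w) \<le> norm (H w) * norm w"
        using Cauchy_Schwarz_ineq2[of "H w" w] by linarith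
      moreover have "norm (H w) * norm w \<le> B * norm w * norm w"
        by (intro mult_right_mono B) auto
      ultimately show ?thesis by (simp add: power2_eq_square)
    qed
    hence "H v = 0" by (rule inner_zero_from_quadratic_bound)
    with inj[of v] v show False by simp
  qed
  hence "0 < m" using semi[of v] by (simp add: m_def)
  moreover have "H w \<bullet> w \<le> - m * (norm w)\<^sup>2" for w
  proof (cases "w = 0")
    case False
    let ?u = "w /\<^sub>R norm w"
    have w: "w = norm w *\<^sub>R ?u" using False by simp
    have "H w \<bullet> w = (norm w)\<^sup>2 * (H ?u \<bullet> ?u)"
      by (subst (1 2) w, subst H.scale) (simp only: inner_scaleR_left inner_scaleR_right power2_eq_square mult_ac)
    moreover have "H ?u \<bullet> ?u \<le> - m" unfolding m_def using max[of ?u] False by simp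
    ultimately show ?thesis by (metis mult.commute mult_left_mono zero_le_power2)
  qed (simp add: H.zero)
  ultimately show thesis using that by blast
qed

lemma strongly_monotone_from_derivative:
  fixes G :: "'a::real_inner \<Rightarrow> 'a"
  assumes der: "\<And>x. (G has_derivative G' x) (at x)"
    and S: "convex S" "p \<in> S" "q \<in> S"
    and neg: "\<And>x v. x \<in> S \<Longrightarrow> G' x v \<bullet> v \<le> - m * (norm v)\<^sup>2"
  shows "(G p - G q) \<bullet> (p - q) \<le> - m * (norm (p - q))\<^sup>2"
proof -
  have d: "((\<lambda>t. G (q + t *\<^sub>R (p - q)) \<bullet> (p - q)) has_real_derivative
      G' (q + t *\<^sub>R (p - q)) (p - q) \<bullet> (p - q)) (at t)" for t
  proof -
    have "((\<lambda>t. q + t *\<^sub>R (p - q)) has_derivative (\<lambda>s. s *\<^sub>R (p - q))) (at t)"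
      by (auto intro!: derivative_eq_intros)
    from diff_chain_at[OF this der]
    have "((\<lambda>t. G (q + t *\<^sub>R (p - q))) has_derivative
        (\<lambda>s. G' (q + t *\<^sub>R (p - q)) (s *\<^sub>R (p - q)))) (at t)" by (simp add: o_def)
    moreover have "G' x (s *\<^sub>R v) = s *\<^sub>R G' x v" for x s v
      using has_derivative_linear[OF der] by (rule linear_scale)
    ultimately show ?thesis
      by (auto simp: has_field_derivative_def mult.commute intro!: derivative_eq_intros)
  qed
  obtain t where t: "0 < t" "t < 1" and eq: "G p \<bullet> (p - q) - G q \<bullet> (p - q)
      = G' (q + t *\<^sub>R (p - q)) (p - q) \<bullet> (p - q)"
    using MVT2[of 0 1, OF _ d] by auto
  have "q + t *\<^sub>R (p - q) \<in> S"
    using convexD_alt[OF S(1) S(3) S(2), of t] t by (simp add: algebra_simps)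
  from neg[OF this] eq show ?thesis by (simp add: inner_diff_left)
qed

lemma grad_strongly_monotone_near_mode:
  fixes f :: "real^'n \<Rightarrow> real"
  assumes f_diff: "\<And>x. f differentiable (at x)"
    and grad_diff: "\<And>x. grad f differentiable (at x)"
    and hess_cont: "continuous (at a) (hess f)"
    and nonsing: "invertible (hess f a)"
    and mode: "is_mode f a"
  obtains m r where "0 < m" "0 < r"
    "\<And>x y. x \<in> ball a r \<Longrightarrow> y \<in> ball a r \<Longrightarrow>
      (grad f x - grad f y) \<bullet> (x - y) \<le> - m * (norm (x - y))\<^sup>2"
proof -
  note der = has_derivative_grad[OF f_diff] and der2 = has_derivative_hess[OF grad_diff]
  obtain m where m: "0 < m" "\<And>w. (hess f a *v w) \<bullet> w \<le> - m * (norm w)\<^sup>2"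
  proof (rule negative_definite_from_semidefinite[of "(*v) (hess f a)"])
    show "(hess f a *v u) \<bullet> v = (hess f a *v v) \<bullet> u" for u v
      by (rule second_derivative_symmetric[OF der der2])
    show "(hess f a *v w) \<bullet> w \<le> 0" for w
      using mode by (intro second_order_necessary[OF der der2]) (simp add: is_mode_def)
    show "w = 0" if "hess f a *v w = 0" for w
      using nonsing that by (metis invertible_def matrix_left_invertible_ker)
  qed auto
  define N where "N = real (CARD('n)) * real (CARD('n))"
  have N: "0 < N" by (simp add: N_def)
  from hess_cont have "\<forall>e>0. \<exists>d>0. \<forall>x. dist x a < d \<longrightarrow> dist (hess f x) (hess f a) < e"
    by (simp add: continuous_at_eps_delta)
  moreover have "0 < m / (2 * N)" using m N by simp
  ultimately obtain r where r: "0 < r" "\<And>x. dist x a < r \<Longrightarrow> dist (hess f x) (hess f a) < m / (2 * N)"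
    by blast
  have "(hess f x *v v) \<bullet> v \<le> - (m / 2) * (norm v)\<^sup>2" if "x \<in> ball a r" for x v
  proof -
    have "norm ((hess f x - hess f a) *v v) \<le> N * norm (hess f x - hess f a) * norm v"
      unfolding N_def by (rule norm_matrix_vector_mult_le)
    also have "\<dots> \<le> N * (m / (2 * N)) * norm v"
      using r(2)[of x] that N by (intro mult_right_mono mult_left_mono) (auto simp: dist_norm norm_minus_commute)
    also have "\<dots> = m / 2 * norm v" using N by simp
    finally have "norm ((hess f x - hess f a) *v v) * norm v \<le> m / 2 * norm v * norm v"
      by (intro mult_right_mono) auto
    moreover have "((hess f x - hess f a) *v v) \<bullet> v \<le> norm ((hess f x - hess f a) *v v) * norm v"
      by (rule norm_cauchy_schwarz)
    moreover have "(hess f x *v v) \<bullet> v = ((hess f x - hess f a) *v v) \<bullet> v + (hess f a *v v) \<bullet> v"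
      by (simp add: matrix_vector_mult_diff_rdistrib inner_diff_left)
    ultimately show ?thesis using m(2)[of v] by (simp add: power2_eq_square)
  qed
  hence "(grad f x - grad f y) \<bullet> (x - y) \<le> - (m / 2) * (norm (x - y))\<^sup>2"
    if "x \<in> ball a r" "y \<in> ball a r" for x y
    using that by (intro strongly_monotone_from_derivative[OF der2 convex_ball]) auto
  with that[of "m / 2" r] m r show thesis by simp
qed

section \<open>Averages against a probability kernel\<close>

text \<open>The average is taken against \<open>K\<close> itself, with the bandwidth moved into the argument of \<open>F\<close>.
  Thus different points and bandwidths are compared under one and the same measure. For even \<open>K\<close>
  this is the convolution with the rescaled kernel.\<close>

definition kernel_avg ::
  "('a::euclidean_space \<Rightarrow> real) \<Rightarrow> real \<Rightarrow> ('a \<Rightarrow> 'b::euclidean_space) \<Rightarrow> 'a \<Rightarrow> 'b" where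
  "kernel_avg K h F x = (LINT z|lborel. K z *\<^sub>R F (x + h *\<^sub>R z))"

text \<open>A truncated first moment of the rescaled kernel. It controls the distance of an average from the
  averaged function, and it tends to 0 with \<open>h\<close> even if the first moment of the kernel is infinite.\<close>

definition spread :: "('a::euclidean_space \<Rightarrow> real) \<Rightarrow> real \<Rightarrow> real" where
  "spread K h = (LINT z|lborel. K z * min 1 (h * norm z))"

locale probability_kernel =
  fixes K :: "'a::euclidean_space \<Rightarrow> real"
  assumes nonneg: "\<And>z. 0 \<le> K z"
    and total: "has_bochner_integral lborel K 1"
begin

lemma integrable_kernel: "integrable lborel K" and integral_kernel: "integral\<^sup>L lborel K = 1"
  using total by (auto simp: has_bochner_integral_iff)

lemma measurable_kernel [measurable]: "K \<in> borel_measurable lborel"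
  using integrable_kernel by (rule borel_measurable_integrable)

lemma integrable_weighted:
  fixes u :: "'a \<Rightarrow> 'b::euclidean_space"
  assumes [measurable]: "u \<in> borel_measurable lborel" and bound: "\<And>z. norm (u z) \<le> B"
  shows "integrable lborel (\<lambda>z. K z *\<^sub>R u z)"
proof (rule Bochner_Integration.integrable_bound)
  show "integrable lborel (\<lambda>z. K z * B)" using integrable_kernel by simp
  show "AE z in lborel. norm (K z *\<^sub>R u z) \<le> norm (K z * B)"
    using bound nonneg by (auto simp: abs_mult intro!: mult_left_mono order_trans[OF bound])
qed measurable

lemma integrable_avg:
  fixes F :: "'a \<Rightarrow> 'b::euclidean_space"
  assumes F: "continuous_on UNIV F" and bound: "\<And>x. norm (F x) \<le> B"
  shows "integrable lborel (\<lambda>z. K z *\<^sub>R F (x + h *\<^sub>R z))"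
proof (rule integrable_weighted)
  have "continuous_on UNIV (\<lambda>z. F (x + h *\<^sub>R z))"
    by (intro continuous_on_compose2[OF F] continuous_intros) auto
  thus "(\<lambda>z. F (x + h *\<^sub>R z)) \<in> borel_measurable lborel"
    using borel_measurable_continuous_onI by simp
qed (rule bound)

lemma integral_weighted_const: "(LINT z|lborel. K z *\<^sub>R c) = c"
  for c :: "'b::euclidean_space"
  using integrable_kernel integral_kernel by simp

lemma norm_integral_weighted_le:
  fixes u :: "'a \<Rightarrow> 'b::euclidean_space"
  assumes "integrable lborel (\<lambda>z. K z *\<^sub>R u z)" "integrable lborel (\<lambda>z. K z * b z)"
    and bound: "\<And>z. norm (u z) \<le> b z"
  shows "norm (LINT z|lborel. K z *\<^sub>R u z) \<le> (LINT z|lborel. K z * b z)"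
  using assms(1,2) by (rule Bochner_Integration.integral_norm_bound_integral)
    (auto simp: nonneg intro!: mult_left_mono bound)

lemma norm_kernel_avg_le:
  fixes F :: "'a \<Rightarrow> 'b::euclidean_space"
  assumes "continuous_on UNIV F" "\<And>x. norm (F x) \<le> B"
  shows "norm (kernel_avg K h F x) \<le> B"
proof -
  have "norm (kernel_avg K h F x) \<le> (LINT z|lborel. K z * B)"
    unfolding kernel_avg_def using integrable_kernel assms
    by (intro norm_integral_weighted_le integrable_avg) auto
  thus ?thesis using integral_kernel by simp
qed

lemma kernel_avg_lipschitz:
  fixes F :: "'a \<Rightarrow> 'b::euclidean_space"
  assumes lip: "M-lipschitz_on UNIV F" and bound: "\<And>x. norm (F x) \<le> B"
  shows "M-lipschitz_on UNIV (kernel_avg K h F)"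
proof (rule lipschitz_onI)
  fix x y
  note int = integrable_avg[OF lipschitz_on_continuous_on[OF lip] bound]
  have "norm (kernel_avg K h F x - kernel_avg K h F y)
      = norm (LINT z|lborel. K z *\<^sub>R (F (x + h *\<^sub>R z) - F (y + h *\<^sub>R z)))"
    unfolding kernel_avg_def scaleR_diff_right
    by (subst Bochner_Integration.integral_diff[OF int int]) simp
  also have "\<dots> \<le> (LINT z|lborel. K z * (M * norm (x - y)))"
  proof (rule norm_integral_weighted_le)
    show "integrable lborel (\<lambda>z. K z *\<^sub>R (F (x + h *\<^sub>R z) - F (y + h *\<^sub>R z)))"
      unfolding scaleR_diff_right by (intro Bochner_Integration.integrable_diff int)
    show "norm (F (x + h *\<^sub>R z) - F (y + h *\<^sub>R z)) \<le> M * norm (x - y)" for z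
      using lipschitz_on_normD[OF lip, of "x + h *\<^sub>R z" "y + h *\<^sub>R z"] by simp
  qed (use integrable_kernel in simp)
  also have "\<dots> = M * norm (x - y)" using integral_kernel by simp
  finally show "dist (kernel_avg K h F x) (kernel_avg K h F y) \<le> M * dist x y"
    by (simp add: dist_norm)
qed (use lip lipschitz_on_nonneg in blast)

lemma integrable_spread: "0 \<le> h \<Longrightarrow> integrable lborel (\<lambda>z. K z * min 1 (h * norm z))"
  using integrable_weighted[of "\<lambda>z. min 1 (h * norm z)" 1] by simp

text \<open>The integrand is dominated by \<open>K\<close> and tends to 0 pointwise; since the spread is monotone in \<open>h\<close>,
  convergence along \<open>h = 1 / (n + 1)\<close> is enough.\<close>

lemma spread_tendsto_0: "(spread K \<longlongrightarrow> 0) (at_right 0)"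
proof -
  have lim: "(\<lambda>n. spread K (1 / real (Suc n))) \<longlonglongrightarrow> 0"
  proof -
    have "(\<lambda>n. LINT z|lborel. K z * min 1 (1 / real (Suc n) * norm z))
        \<longlonglongrightarrow> integral\<^sup>L lborel (\<lambda>z::'a. 0::real)"
    proof (rule integral_dominated_convergence[where w=K])
      show "AE z in lborel. (\<lambda>n. K z * min 1 (1 / real (Suc n) * norm z)) \<longlonglongrightarrow> 0"
      proof (rule AE_I2)
        fix z :: 'a
        have "(\<lambda>n. K z * min 1 (1 / real (Suc n) * norm z)) \<longlonglongrightarrow> K z * min 1 (0 * norm z)"
          by (intro tendsto_intros LIMSEQ_Suc lim_1_over_n)
        thus "(\<lambda>n. K z * min 1 (1 / real (Suc n) * norm z)) \<longlonglongrightarrow> 0" by simp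
      qed
      show "AE z in lborel. norm (K z * min 1 (1 / real (Suc n) * norm z)) \<le> K z" for n
        using nonneg by (auto simp: abs_mult intro!: mult_left_le)
    qed (use integrable_kernel in measurable)
    thus ?thesis by (simp add: spread_def)
  qed
  have mono: "spread K h \<le> spread K h'" if "0 \<le> h" "h \<le> h'" for h h'
    unfolding spread_def using that nonneg integrable_spread
    by (intro integral_mono mult_left_mono min.mono mult_right_mono) auto
  have pos: "0 \<le> spread K h" if "0 \<le> h" for h
    unfolding spread_def using that nonneg by (intro Bochner_Integration.integral_nonneg) auto
  show ?thesis
  proof (rule tendstoI)
    fix e :: real assume "0 < e"
    from order_tendstoD(2)[OF lim this] obtain n where n: "spread K (1 / real (Suc n)) < e"
      by (auto simp: eventually_sequentially)
    show "\<forall>\<^sub>F h in at_right 0. dist (spread K h) 0 < e"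
      unfolding eventually_at_right_field
    proof (intro exI[of _ "1 / real (Suc n)"] conjI allI impI)
      fix h :: real assume h: "0 < h" "h < 1 / real (Suc n)"
      from mono[of h "1 / real (Suc n)"] pos[of h] n h show "dist (spread K h) 0 < e" by simp
    qed simp
  qed
qed

lemma kernel_avg_approx:
  fixes F :: "'a \<Rightarrow> 'b::euclidean_space"
  assumes lip: "M-lipschitz_on UNIV F" and bound: "\<And>x. norm (F x) \<le> B" and h: "0 \<le> h"
  shows "norm (kernel_avg K h F x - F x) \<le> (2 * B + M) * spread K h"
proof -
  note int = integrable_avg[OF lipschitz_on_continuous_on[OF lip] bound]
  have B: "0 \<le> B" using bound[of 0] norm_ge_zero order_trans by blast
  have M: "0 \<le> M" using lip by (rule lipschitz_on_nonneg)
  have intc: "integrable lborel (\<lambda>z. K z *\<^sub>R F x)" using integrable_kernel by simp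
  have "kernel_avg K h F x - F x = (LINT z|lborel. K z *\<^sub>R (F (x + h *\<^sub>R z) - F x))"
    unfolding scaleR_diff_right Bochner_Integration.integral_diff[OF int intc]
    by (simp add: integral_weighted_const kernel_avg_def)
  also have "norm \<dots> \<le> (LINT z|lborel. K z * ((2 * B + M) * min 1 (h * norm z)))"
  proof (rule norm_integral_weighted_le)
    show "integrable lborel (\<lambda>z. K z *\<^sub>R (F (x + h *\<^sub>R z) - F x))"
      unfolding scaleR_diff_right by (intro Bochner_Integration.integrable_diff int intc)
    show "integrable lborel (\<lambda>z. K z * ((2 * B + M) * min 1 (h * norm z)))"
      using integrable_mult_right[OF integrable_spread[OF h], of "2 * B + M"] by (simp add: mult.left_commute)
    show "norm (F (x + h *\<^sub>R z) - F x) \<le> (2 * B + M) * min 1 (h * norm z)" for z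
    proof -
      have "norm (F (x + h *\<^sub>R z) - F x) \<le> M * (h * norm z)"
        using lipschitz_on_normD[OF lip, of "x + h *\<^sub>R z" x] h by simp
      also have "\<dots> \<le> (2 * B + M) * (h * norm z)" using B h by (intro mult_right_mono) auto
      finally have "norm (F (x + h *\<^sub>R z) - F x) \<le> (2 * B + M) * (h * norm z)" .
      moreover have "norm (F (x + h *\<^sub>R z) - F x) \<le> 2 * B + M"
        using norm_triangle_ineq4[of "F (x + h *\<^sub>R z)" "F x"] bound[of x] bound[of "x + h *\<^sub>R z"] M
        by linarith
      ultimately show ?thesis by (simp add: min_def)
    qed
  qed
  also have "\<dots> = (2 * B + M) * spread K h"
    unfolding spread_def by (subst integral_mult_right_zero[symmetric]) (simp add: mult.left_commute)
  finally show ?thesis .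
qed

lemma kernel_avg_linear_approx:
  fixes g :: "'a \<Rightarrow> real" and G :: "'a \<Rightarrow> 'a"
  assumes g: "continuous_on UNIV g" "\<And>x. norm (g x) \<le> A"
    and G: "continuous_on UNIV G" "\<And>x. norm (G x) \<le> B"
    and approx: "\<And>x w. \<bar>g (x + w) - g x - G x \<bullet> w\<bar> \<le> M * (norm w)\<^sup>2"
  shows "\<bar>kernel_avg K h g (x + w) - kernel_avg K h g x - kernel_avg K h G x \<bullet> w\<bar> \<le> M * (norm w)\<^sup>2"
proof -
  note intg = integrable_avg[OF g] and intG = integrable_avg[OF G]
  have intGw: "integrable lborel (\<lambda>z. K z *\<^sub>R (G (x + h *\<^sub>R z) \<bullet> w))"
  proof -
    have "integrable lborel (\<lambda>z. (K z *\<^sub>R G (x + h *\<^sub>R z)) \<bullet> w)"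
      by (intro integrable_inner_left intG)
    thus ?thesis by simp
  qed
  have int: "integrable lborel (\<lambda>z. K z *\<^sub>R (g (x + w + h *\<^sub>R z) - g (x + h *\<^sub>R z) - G (x + h *\<^sub>R z) \<bullet> w))"
    unfolding scaleR_diff_right by (intro Bochner_Integration.integrable_diff intg intGw)
  have "kernel_avg K h G x \<bullet> w = (LINT z|lborel. K z *\<^sub>R (G (x + h *\<^sub>R z) \<bullet> w))"
    unfolding kernel_avg_def by (subst integral_inner_left[OF intG, symmetric]) simp
  hence "kernel_avg K h g (x + w) - kernel_avg K h g x - kernel_avg K h G x \<bullet> w
      = (LINT z|lborel. K z *\<^sub>R (g (x + w + h *\<^sub>R z) - g (x + h *\<^sub>R z) - G (x + h *\<^sub>R z) \<bullet> w))"
    unfolding scaleR_diff_right kernel_avg_def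
    by (simp only: Bochner_Integration.integral_diff Bochner_Integration.integrable_diff intg intGw)
  also have "norm \<dots> \<le> (LINT z|lborel. K z * (M * (norm w)\<^sup>2))"
  proof (rule norm_integral_weighted_le[OF int])
    show "norm (g (x + w + h *\<^sub>R z) - g (x + h *\<^sub>R z) - G (x + h *\<^sub>R z) \<bullet> w) \<le> M * (norm w)\<^sup>2" for z
      using approx[of "x + h *\<^sub>R z" w] by (simp add: ac_simps)
  qed (use integrable_kernel in simp)
  also have "\<dots> = M * (norm w)\<^sup>2" using integral_kernel by simp
  finally show ?thesis by simp
qed

text \<open>Displacements \<open>h z\<close> of length at most \<open>R\<close> keep both points in the larger ball, where \<open>G\<close> is strongly
  monotone. For the others only the Lipschitz bound is available, but \<open>1 \<le> min 1 (h |z|) / R\<close> there,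
  so their total weight is at most the spread divided by \<open>R\<close>.\<close>

lemma kernel_avg_strongly_monotone:
  fixes G :: "'a \<Rightarrow> 'a"
  assumes lip: "M-lipschitz_on UNIV G" and bound: "\<And>x. norm (G x) \<le> B"
    and mono: "\<And>x y. x \<in> cball a (2 * R) \<Longrightarrow> y \<in> cball a (2 * R) \<Longrightarrow>
      (G x - G y) \<bullet> (x - y) \<le> - m * (norm (x - y))\<^sup>2"
    and R: "0 < R" "R \<le> 1" and h: "0 \<le> h" and m: "0 \<le> m"
    and x: "x \<in> cball a R" and y: "y \<in> cball a R"
  shows "(kernel_avg K h G x - kernel_avg K h G y) \<bullet> (x - y)
    \<le> - (m - (M + m) * spread K h / R) * (norm (x - y))\<^sup>2"
proof -
  note int = integrable_avg[OF lipschitz_on_continuous_on[OF lip] bound]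
  have M: "0 \<le> M" using lip by (rule lipschitz_on_nonneg)
  let ?D = "\<lambda>z. G (x + h *\<^sub>R z) - G (y + h *\<^sub>R z)"
  let ?N = "(norm (x - y))\<^sup>2"
  have intD: "integrable lborel (\<lambda>z. K z *\<^sub>R ?D z)"
    unfolding scaleR_diff_right by (intro Bochner_Integration.integrable_diff int)
  have "kernel_avg K h G x - kernel_avg K h G y = (LINT z|lborel. K z *\<^sub>R ?D z)"
    unfolding scaleR_diff_right kernel_avg_def
    by (subst Bochner_Integration.integral_diff[OF int int]) simp
  hence "(kernel_avg K h G x - kernel_avg K h G y) \<bullet> (x - y)
      = (LINT z|lborel. K z * (?D z \<bullet> (x - y)))"
    using integral_inner_left[OF intD, of "x - y"] by simp
  also have "\<dots> \<le> (LINT z|lborel. - m * ?N * K z + (M + m) / R * ?N * (K z * min 1 (h * norm z)))"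
  proof (rule integral_mono)
    show "integrable lborel (\<lambda>z. K z * (?D z \<bullet> (x - y)))"
      using integrable_inner_left[OF intD, of "x - y"] by simp
    show "integrable lborel (\<lambda>z. - m * ?N * K z + (M + m) / R * ?N * (K z * min 1 (h * norm z)))"
      using integrable_kernel integrable_spread[OF h] by simp
    fix z
    have "?D z \<bullet> (x - y) \<le> - m * ?N + (M + m) / R * ?N * min 1 (h * norm z)"
    proof (cases "h * norm z \<le> R")
      case True
      have "dist a (p + h *\<^sub>R z) \<le> 2 * R" if "p \<in> cball a R" for p
      proof -
        have "dist a (p + h *\<^sub>R z) \<le> dist a p + dist p (p + h *\<^sub>R z)" by (rule dist_triangle)
        also have "dist p (p + h *\<^sub>R z) = h * norm z" using h by (simp add: dist_norm)
        finally show ?thesis using that True by simp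
      qed
      hence "?D z \<bullet> (x - y) \<le> - m * ?N"
        using mono[of "x + h *\<^sub>R z" "y + h *\<^sub>R z"] x y by simp
      moreover have "0 \<le> (M + m) / R * ?N * min 1 (h * norm z)"
        using M m R h by simp
      ultimately show ?thesis by linarith
    next
      case False
      have "?D z \<bullet> (x - y) \<le> norm (?D z) * norm (x - y)" by (rule norm_cauchy_schwarz)
      also have "\<dots> \<le> M * norm (x - y) * norm (x - y)"
        using lipschitz_on_normD[OF lip, of "x + h *\<^sub>R z" "y + h *\<^sub>R z"]
        by (intro mult_right_mono) auto
      also have "\<dots> = - m * ?N + (M + m) * ?N * 1" by (simp add: power2_eq_square algebra_simps)
      also have "\<dots> \<le> - m * ?N + (M + m) * ?N * (min 1 (h * norm z) / R)"
        using False R M m by (intro add_left_mono mult_left_mono) auto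
      finally show ?thesis by simp
    qed
    from mult_left_mono[OF this nonneg[of z]]
    show "K z * (?D z \<bullet> (x - y)) \<le> - m * ?N * K z + (M + m) / R * ?N * (K z * min 1 (h * norm z))"
      by (simp add: algebra_simps)
  qed
  also have "\<dots> = - m * ?N + (M + m) / R * ?N * spread K h"
    using integrable_kernel integral_kernel integrable_spread[OF h] by (simp add: spread_def)
  finally show ?thesis by (simp add: algebra_simps)
qed

end

section \<open>Mean Shift as a gradient step for the shadow average\<close>

lemma integral_lborel_affine:
  fixes g :: "'a::euclidean_space \<Rightarrow> 'b::euclidean_space"
  assumes g [measurable]: "g \<in> borel_measurable borel" and h: "h \<noteq> 0"
  shows "(LINT y|lborel. g y) = (LINT z|lborel. \<bar>h\<bar> ^ DIM('a) *\<^sub>R g (x + h *\<^sub>R z))"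
  by (subst lborel_affine[OF h, of x], subst integral_density, simp_all, subst integral_distr) auto

lemma integrable_lborel_affine:
  fixes g :: "'a::euclidean_space \<Rightarrow> 'b::euclidean_space"
  assumes int: "integrable lborel g" and h: "h \<noteq> 0"
  shows "integrable lborel (\<lambda>z. g (x + h *\<^sub>R z))"
proof -
  have [measurable]: "g \<in> borel_measurable borel" using int by simp
  have "integrable (density (distr lborel borel (\<lambda>z. x + h *\<^sub>R z)) (\<lambda>_. \<bar>h\<bar> ^ DIM('a))) g"
    using int by (subst (asm) lborel_affine[OF h, of x])
  hence "integrable (distr lborel borel (\<lambda>z. x + h *\<^sub>R z)) (\<lambda>y. \<bar>h\<bar> ^ DIM('a) *\<^sub>R g y)"
    by (subst (asm) integrable_density) auto
  hence "integrable lborel (\<lambda>z. \<bar>h\<bar> ^ DIM('a) *\<^sub>R g (x + h *\<^sub>R z))"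
    by (subst (asm) integrable_distr_eq) auto
  from integrable_scaleR_right[OF this, of "inverse (\<bar>h\<bar> ^ DIM('a))"] show ?thesis using h by simp
qed

locale shadow_kernel =
  fixes k :: "real \<Rightarrow> real" and c :: real and K L :: "real^'n \<Rightarrow> real"
  assumes k_nonneg: "\<And>u. 0 \<le> u \<Longrightarrow> 0 \<le> k u"
    and k_antimono: "antimono_on {0..} k"
    and k_integrable: "set_integrable lborel {0..} k"
    and K_def: "K = radial k"
    and K_kernel: "has_bochner_integral lborel K 1"
    and c_pos: "0 < c"
    and L_def: "L = radial (shadow_profile k c)"
    and L_kernel: "has_bochner_integral lborel L 1"
begin

lemma profile_antimono: "0 \<le> u \<Longrightarrow> u \<le> v \<Longrightarrow> k v \<le> k u"
  using k_antimono by (auto simp: monotone_on_def)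

lemma profile_set_integrable: "A \<subseteq> {0..} \<Longrightarrow> A \<in> sets borel \<Longrightarrow> set_integrable lborel A k"
  using k_integrable by (rule set_integrable_subset) auto

lemma shadow_diff:
  assumes "0 \<le> a" "a \<le> b"
  shows "shadow_profile k c a - shadow_profile k c b = c * (LINT v:{a..<b}|lborel. k v)"
proof -
  have "{a..} = {a..<b} \<union> {b..}" using assms by auto
  hence "(LINT v:{a..}|lborel. k v) = (LINT v:{a..<b}|lborel. k v) + (LINT v:{b..}|lborel. k v)"
    using assms by (simp only:) (intro set_integral_Un profile_set_integrable; auto)
  thus ?thesis by (simp add: shadow_profile_def algebra_simps)
qed

lemma interval_integral_bounds:
  assumes ab: "0 \<le> a" "a \<le> b"
  shows "k b * (b - a) \<le> (LINT v:{a..<b}|lborel. k v)"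
    and "(LINT v:{a..<b}|lborel. k v) \<le> k a * (b - a)"
proof -
  have int: "set_integrable lborel {a..<b} k" using ab by (intro profile_set_integrable) auto
  have const: "set_integrable lborel {a..<b} (\<lambda>_. d)" "(LINT v:{a..<b}|lborel. d) = d * (b - a)" for d :: real
    using ab by (auto simp: set_integrable_def set_lebesgue_integral_def)
  show "k b * (b - a) \<le> (LINT v:{a..<b}|lborel. k v)"
    unfolding const(2)[symmetric] using ab by (intro set_integral_mono const int profile_antimono) auto
  show "(LINT v:{a..<b}|lborel. k v) \<le> k a * (b - a)"
    unfolding const(2)[symmetric] using ab by (intro set_integral_mono const int profile_antimono) auto
qed

text \<open>Convexity of the shadow profile: \<open>-c k u\<close> is a subgradient at \<open>u\<close>, also where \<open>k\<close> jumps.\<close>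

lemma shadow_tangent:
  assumes "0 \<le> u" "0 \<le> v"
  shows "shadow_profile k c u - c * k u * (v - u) \<le> shadow_profile k c v"
proof (cases "u \<le> v")
  case True
  have "c * (LINT v:{u..<v}|lborel. k v) \<le> c * (k u * (v - u))"
    using c_pos interval_integral_bounds[OF assms(1) True] by (intro mult_left_mono) auto
  with shadow_diff[OF assms(1) True] show ?thesis by (simp add: mult.assoc)
next
  case False
  hence "c * (k u * (u - v)) \<le> c * (LINT v:{v..<u}|lborel. k v)"
    using c_pos interval_integral_bounds[OF assms(2)] by (intro mult_left_mono) auto
  with shadow_diff[OF assms(2), of u] False show ?thesis by (simp add: algebra_simps)
qed

lemma shadow_nonneg: "0 \<le> u \<Longrightarrow> 0 \<le> shadow_profile k c u"
  unfolding shadow_profile_def set_lebesgue_integral_def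
  using c_pos k_nonneg by (intro mult_nonneg_nonneg Bochner_Integration.integral_nonneg)
    (auto simp: indicator_def)

sublocale K: probability_kernel K
  by unfold_locales (use k_nonneg K_kernel in \<open>auto simp: K_def radial_def\<close>)

sublocale L: probability_kernel L
  by unfold_locales (use shadow_nonneg L_kernel in \<open>auto simp: L_def radial_def\<close>)

text \<open>Monotonicity of \<open>k\<close> gives \<open>c u k (2 u) \<le> \<integral> c k\<close> over \<open>[u, 2 u]\<close>, which is at most the shadow
  profile at \<open>u\<close>; with \<open>2 u = |z|\<^sup>2\<close> the second moment of \<open>K\<close> is dominated by a dilate of \<open>L\<close>.\<close>

lemma second_moment_finite: "integrable lborel (\<lambda>z. K z * (norm z)\<^sup>2)"
proof (rule Bochner_Integration.integrable_bound)
  show "integrable lborel (\<lambda>z. 2 / c * L (0 + (1 / sqrt 2) *\<^sub>R z))"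
    by (intro integrable_mult_right integrable_lborel_affine L.integrable_kernel) auto
  show "AE z in lborel. norm (K z * (norm z)\<^sup>2) \<le> norm (2 / c * L (0 + (1 / sqrt 2) *\<^sub>R z))"
  proof (rule AE_I2)
    fix z :: "real^'n"
    define u where "u = (norm z)\<^sup>2 / 2"
    have u: "0 \<le> u" by (simp add: u_def)
    have "c * k (2 * u) * u \<le> shadow_profile k c u"
      using shadow_tangent[of "2 * u" u] shadow_nonneg[of "2 * u"] u by (simp add: algebra_simps)
    moreover have "L (0 + (1 / sqrt 2) *\<^sub>R z) = shadow_profile k c u"
      by (simp add: L_def radial_def u_def power_divide)
    ultimately have "c * (K z * (norm z)\<^sup>2 / 2) \<le> L (0 + (1 / sqrt 2) *\<^sub>R z)"
      by (simp add: u_def K_def radial_def mult.assoc)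
    hence "K z * (norm z)\<^sup>2 \<le> 2 / c * L (0 + (1 / sqrt 2) *\<^sub>R z)"
      using c_pos by (simp add: field_simps)
    thus "norm (K z * (norm z)\<^sup>2) \<le> norm (2 / c * L (0 + (1 / sqrt 2) *\<^sub>R z))"
      using K.nonneg by (simp add: abs_mult) (use c_pos L.nonneg in \<open>simp add: abs_mult\<close>)
  qed
qed measurable

text \<open>The numerator of the Mean Shift converges, by \<open>|z| \<le> 1 + |z|\<^sup>2\<close> and the second moment.\<close>

lemma integrable_first_moment:
  assumes [measurable]: "u \<in> borel_measurable borel" and bound: "\<And>z. \<bar>u z\<bar> \<le> A"
  shows "integrable lborel (\<lambda>z. (K z * u z) *\<^sub>R z)"
proof (rule Bochner_Integration.integrable_bound)
  show "integrable lborel (\<lambda>z. A * (K z + K z * (norm z)\<^sup>2))"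
    using K.integrable_kernel second_moment_finite by simp
  show "AE z in lborel. norm ((K z * u z) *\<^sub>R z) \<le> norm (A * (K z + K z * (norm z)\<^sup>2))"
  proof (rule AE_I2)
    fix z :: "real^'n"
    have A: "0 \<le> A" using bound[of z] by linarith
    have "norm z \<le> 1 + (norm z)\<^sup>2"
      using sum_squares_bound[of "norm z" 1] zero_le_power2[of "norm z"] by (simp add: power2_eq_square) (use norm_ge_zero[of z] in linarith)
    hence "\<bar>u z\<bar> * (K z * norm z) \<le> A * (K z * (1 + (norm z)\<^sup>2))"
      using K.nonneg bound A by (intro mult_mono mult_left_mono) auto
    also have "\<dots> \<le> norm (A * (K z + K z * (norm z)\<^sup>2))" by (simp add: algebra_simps)
    finally show "norm ((K z * u z) *\<^sub>R z) \<le> norm (A * (K z + K z * (norm z)\<^sup>2))"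
      using K.nonneg by (simp add: abs_mult mult_ac)
  qed
qed measurable

text \<open>Substituting \<open>y = x + h z\<close> puts the shift into the kernel rather than into \<open>f\<close>; in this form the
  tangent inequality for the profile of \<open>L\<close> applies under the integral.\<close>

lemma convolve_shifted:
  assumes f: "f \<in> borel_measurable borel" and h: "0 < h"
  shows "convolve (rescale h L) f (x + w) = (LINT z|lborel. L (w /\<^sub>R h - z) * f (x + h *\<^sub>R z))"
proof -
  note [measurable] = f L.measurable_kernel[simplified]
  have "convolve (rescale h L) f (x + w)
      = (LINT z|lborel. \<bar>h\<bar> ^ DIM(real^'n) *\<^sub>R
          (rescale h L (x + w - (x + h *\<^sub>R z)) * f (x + h *\<^sub>R z)))"
    unfolding convolve_def using h
    by (intro integral_lborel_affine) (auto simp: rescale_def)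
  also have "\<dots> = (LINT z|lborel. L (w /\<^sub>R h - z) * f (x + h *\<^sub>R z))"
  proof (rule Bochner_Integration.integral_cong[OF refl])
    fix z
    have "(x + w - (x + h *\<^sub>R z)) /\<^sub>R h = w /\<^sub>R h - z"
      using h by (simp add: scaleR_diff_right)
    thus "\<bar>h\<bar> ^ DIM(real^'n) *\<^sub>R (rescale h L (x + w - (x + h *\<^sub>R z)) * f (x + h *\<^sub>R z))
        = L (w /\<^sub>R h - z) * f (x + h *\<^sub>R z)"
      using h by (simp add: rescale_def)
  qed
  finally show ?thesis .
qed

lemma convolve_eq_kernel_avg:
  assumes "f \<in> borel_measurable borel" "0 < h"
  shows "convolve (rescale h L) f = kernel_avg L h f"
proof
  fix x
  show "convolve (rescale h L) f x = kernel_avg L h f x"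
    using convolve_shifted[OF assms, of x 0] by (simp add: kernel_avg_def L_def radial_def)
qed

lemma mean_shift_eq:
  assumes f: "f \<in> borel_measurable borel" and h: "0 < h"
  shows "mean_shift K f h x
    = (h / kernel_avg K h f x) *\<^sub>R (LINT z|lborel. (K z * f (x + h *\<^sub>R z)) *\<^sub>R z)"
proof -
  note [measurable] = f K.measurable_kernel[simplified]
  have resc: "\<bar>h\<bar> ^ DIM(real^'n) * rescale h K (x + h *\<^sub>R z - x) = K z" for z
    using h by (simp add: rescale_def)
  have "(LINT y|lborel. (rescale h K (y - x) * f y) *\<^sub>R (y - x))
      = (LINT z|lborel. \<bar>h\<bar> ^ DIM(real^'n) *\<^sub>R
          ((rescale h K (x + h *\<^sub>R z - x) * f (x + h *\<^sub>R z)) *\<^sub>R (x + h *\<^sub>R z - x)))"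
    using h by (intro integral_lborel_affine) (auto simp: rescale_def)
  also have "\<dots> = (LINT z|lborel. h *\<^sub>R ((K z * f (x + h *\<^sub>R z)) *\<^sub>R z))"
    unfolding scaleR_scaleR mult.assoc[symmetric] resc by (simp add: mult_ac)
  finally have num: "(LINT y|lborel. (rescale h K (y - x) * f y) *\<^sub>R (y - x))
      = h *\<^sub>R (LINT z|lborel. (K z * f (x + h *\<^sub>R z)) *\<^sub>R z)" by (simp only: integral_scaleR_right)
  have "(LINT y|lborel. rescale h K (y - x) * f y)
      = (LINT z|lborel. \<bar>h\<bar> ^ DIM(real^'n) *\<^sub>R (rescale h K (x + h *\<^sub>R z - x) * f (x + h *\<^sub>R z)))"
    using h by (intro integral_lborel_affine) (auto simp: rescale_def)
  also have "\<dots> = kernel_avg K h f x"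
    unfolding real_scaleR_def mult.assoc[symmetric] resc by (simp add: kernel_avg_def)
  finally have den: "(LINT y|lborel. rescale h K (y - x) * f y) = kernel_avg K h f x" .
  show ?thesis unfolding mean_shift_def num den by (simp add: divide_inverse mult.commute)
qed

text \<open>Apply the tangent inequality of the shadow profile at \<open>|z|\<^sup>2\<close>, evaluated at \<open>|w / h - z|\<^sup>2\<close>, and
  integrate against the nonnegative function \<open>f\<close>.\<close>

lemma shadow_avg_increment:
  assumes f: "continuous_on UNIV f" "\<And>x. \<bar>f x\<bar> \<le> A" and f_nonneg: "\<And>x. 0 \<le> f x" and h: "0 < h"
  shows "2 * c / h * ((LINT z|lborel. (K z * f (x + h *\<^sub>R z)) *\<^sub>R z) \<bullet> w)
      - c / h\<^sup>2 * kernel_avg K h f x * (norm w)\<^sup>2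
    \<le> kernel_avg L h f (x + w) - kernel_avg L h f x"
proof -
  have fm: "f \<in> borel_measurable borel" using f(1) by (rule borel_measurable_continuous_onI)
  have fxm [measurable]: "(\<lambda>z. f (x + h *\<^sub>R z)) \<in> borel_measurable borel"
    using fm by measurable
  have f': "\<And>x. norm (f x) \<le> A" using f(2) by simp
  let ?m = "\<lambda>z. (K z * f (x + h *\<^sub>R z)) *\<^sub>R z"
  have intm: "integrable lborel ?m"
    using f(2) by (intro integrable_first_moment fxm)
  have intmw: "integrable lborel (\<lambda>z. ?m z \<bullet> w)" by (intro integrable_inner_left intm)
  have intK: "integrable lborel (\<lambda>z. K z * f (x + h *\<^sub>R z))"
    using K.integrable_avg[OF f(1) f'] by simp
  have intL: "integrable lborel (\<lambda>z. L z * f (x + h *\<^sub>R z))"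
    using L.integrable_avg[OF f(1) f'] by simp
  have intLs: "integrable lborel (\<lambda>z. L (w /\<^sub>R h - z) * f (x + h *\<^sub>R z))"
  proof (rule Bochner_Integration.integrable_bound)
    have "integrable lborel (\<lambda>z. L (w /\<^sub>R h + (-1) *\<^sub>R z))"
      by (intro integrable_lborel_affine L.integrable_kernel) auto
    thus "integrable lborel (\<lambda>z. A * L (w /\<^sub>R h - z))" by simp
    show "AE z in lborel. norm (L (w /\<^sub>R h - z) * f (x + h *\<^sub>R z)) \<le> norm (A * L (w /\<^sub>R h - z))"
    proof (rule AE_I2)
      fix z
      show "norm (L (w /\<^sub>R h - z) * f (x + h *\<^sub>R z)) \<le> norm (A * L (w /\<^sub>R h - z))"
        using f(2)[of "x + h *\<^sub>R z"] by (simp add: abs_mult mult.commute mult_right_mono)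
    qed
    show "(\<lambda>z. L (w /\<^sub>R h - z) * f (x + h *\<^sub>R z)) \<in> borel_measurable lborel"
      using fxm L.measurable_kernel[simplified] by measurable
  qed
  have inner: "(LINT z|lborel. ?m z) \<bullet> w = (LINT z|lborel. ?m z \<bullet> w)"
    by (rule integral_inner_left[symmetric]) (rule intm)
  have "2 * c / h * ((LINT z|lborel. ?m z) \<bullet> w) - c / h\<^sup>2 * kernel_avg K h f x * (norm w)\<^sup>2
      = (LINT z|lborel. 2 * c / h * (?m z \<bullet> w) - c / h\<^sup>2 * (norm w)\<^sup>2 * (K z * f (x + h *\<^sub>R z)))"
    unfolding inner using intmw intK
    by (subst Bochner_Integration.integral_diff) (auto simp: kernel_avg_def simp del: integral_inner_left)
  also have "\<dots> \<le> (LINT z|lborel. L (w /\<^sub>R h - z) * f (x + h *\<^sub>R z) - L z * f (x + h *\<^sub>R z))"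
  proof (rule integral_mono)
    fix z
    have sq: "(norm (w /\<^sub>R h - z))\<^sup>2 - (norm z)\<^sup>2 = (norm w)\<^sup>2 / h\<^sup>2 - 2 / h * (z \<bullet> w)"
      using h unfolding power2_norm_eq_inner
      by (simp add: inner_diff_left inner_diff_right inner_commute divide_inverse power2_eq_square)
    have "- c * K z * ((norm (w /\<^sub>R h - z))\<^sup>2 - (norm z)\<^sup>2) \<le> L (w /\<^sub>R h - z) - L z"
      using shadow_tangent[of "(norm z)\<^sup>2" "(norm (w /\<^sub>R h - z))\<^sup>2"]
      by (simp add: K_def L_def radial_def)
    from mult_right_mono[OF this f_nonneg[of "x + h *\<^sub>R z"]]
    show "2 * c / h * (?m z \<bullet> w) - c / h\<^sup>2 * (norm w)\<^sup>2 * (K z * f (x + h *\<^sub>R z))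
        \<le> L (w /\<^sub>R h - z) * f (x + h *\<^sub>R z) - L z * f (x + h *\<^sub>R z)"
      unfolding sq by (simp add: algebra_simps)
  qed (use intmw intK intL intLs in auto)
  also have "\<dots> = kernel_avg L h f (x + w) - kernel_avg L h f x"
    using intL intLs convolve_shifted[OF fm h, of x w]
    by (simp add: convolve_eq_kernel_avg[OF fm h] kernel_avg_def)
  finally show ?thesis .
qed

text \<open>Increments of the shadow average of \<open>f\<close> lie above the linear form of the Mean Shift numerator and
  below the linear form of the averaged gradient, up to quadratic errors, so the two forms agree.
  If the denominator is 0, both sides are 0 by the convention for division.\<close>

lemma mean_shift_is_gradient_step:
  assumes f: "continuous_on UNIV f" "\<And>x. \<bar>f x\<bar> \<le> A" and f_nonneg: "\<And>x. 0 \<le> f x" and h: "0 < h"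
    and G: "continuous_on UNIV G" "\<And>x. norm (G x) \<le> B"
    and approx: "\<And>x w. \<bar>f (x + w) - f x - G x \<bullet> w\<bar> \<le> M * (norm w)\<^sup>2"
  shows "mean_shift K f h x = (h\<^sup>2 / (2 * c * kernel_avg K h f x)) *\<^sub>R kernel_avg L h G x"
proof -
  let ?N = "LINT z|lborel. (K z * f (x + h *\<^sub>R z)) *\<^sub>R z"
  have f': "\<And>x. norm (f x) \<le> A" using f(2) by simp
  have "((2 * c / h) *\<^sub>R ?N - kernel_avg L h G x) \<bullet> w
      \<le> (M + c / h\<^sup>2 * kernel_avg K h f x) * (norm w)\<^sup>2" for w
  proof -
    have "kernel_avg L h f (x + w) - kernel_avg L h f x \<le> kernel_avg L h G x \<bullet> w + M * (norm w)\<^sup>2"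
      using L.kernel_avg_linear_approx[OF f(1) f' G approx, of h x w] by linarith
    with shadow_avg_increment[OF f f_nonneg h, of x w] show ?thesis
      by (simp add: inner_diff_left algebra_simps)
  qed
  hence "(2 * c / h) *\<^sub>R ?N - kernel_avg L h G x = 0" by (rule inner_zero_from_quadratic_bound)
  hence "kernel_avg L h G x = (2 * c / h) *\<^sub>R ?N" by simp
  moreover have "f \<in> borel_measurable borel" using f(1) by (rule borel_measurable_continuous_onI)
  ultimately show ?thesis
    unfolding mean_shift_eq[OF \<open>f \<in> borel_measurable borel\<close> h]
    using h c_pos by (simp add: power2_eq_square)
qed

end

section \<open>Gradient ascent near a maximum\<close>

text \<open>A maximum over the closed ball exists by compactness. It is not on the sphere: there strong
  monotonicity outweighs the small gradient at the centre, so the gradient points strictly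
  inwards and \<open>g\<close> would increase on moving towards the centre.\<close>

lemma interior_max_of_strongly_monotone_gradient:
  fixes g :: "'a::euclidean_space \<Rightarrow> real"
  assumes der: "\<And>x. (g has_derivative (\<lambda>v. G x \<bullet> v)) (at x)"
    and mono: "\<And>x y. x \<in> cball a R \<Longrightarrow> y \<in> cball a R \<Longrightarrow>
      (G x - G y) \<bullet> (x - y) \<le> - m * (norm (x - y))\<^sup>2"
    and R: "0 < R" and m: "0 < m" and small: "norm (G a) < m * R"
  obtains z where "z \<in> ball a R" "G z = 0" "\<And>y. y \<in> cball a R \<Longrightarrow> g y \<le> g z"
    "norm (z - a) \<le> norm (G a) / m"
proof -
  have "continuous_on (cball a R) g"
    using der by (meson continuous_at_imp_continuous_on has_derivative_continuous)
  moreover have "cball a R \<noteq> {}" using R by simp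
  ultimately obtain z where z: "z \<in> cball a R" and max: "\<And>y. y \<in> cball a R \<Longrightarrow> g y \<le> g z"
    using continuous_attains_sup[OF compact_cball] by blast
  have zball: "z \<in> ball a R"
  proof (rule ccontr)
    assume "z \<notin> ball a R"
    with z have nz: "norm (z - a) = R" by (simp add: dist_norm norm_minus_commute)
    have "G z \<bullet> (z - a) = (G z - G a) \<bullet> (z - a) + G a \<bullet> (z - a)" by (simp add: inner_diff_left)
    also have "\<dots> \<le> - m * R\<^sup>2 + norm (G a) * R"
      using mono[of z a] z R nz norm_cauchy_schwarz[of "G a" "z - a"] by (intro add_mono) auto
    also have "\<dots> = R * (norm (G a) - m * R)" by (simp add: power2_eq_square algebra_simps)
    also have "\<dots> < 0" using R small by (simp add: mult_pos_neg)
    finally have pos: "0 < G z \<bullet> (a - z)" by (simp add: inner_diff_right)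
    have "((\<lambda>t. z + t *\<^sub>R (a - z)) has_derivative (\<lambda>s. s *\<^sub>R (a - z))) (at 0)"
      by (auto intro!: derivative_eq_intros)
    moreover have "(g has_derivative (\<lambda>v. G z \<bullet> v)) (at (z + 0 *\<^sub>R (a - z)))" using der by simp
    ultimately have "((\<lambda>t. g (z + t *\<^sub>R (a - z))) has_derivative (\<lambda>s. G z \<bullet> (s *\<^sub>R (a - z)))) (at 0)"
      by (auto dest: diff_chain_at simp: o_def)
    hence "((\<lambda>t. g (z + t *\<^sub>R (a - z))) has_real_derivative G z \<bullet> (a - z)) (at 0)"
      by (simp add: has_field_derivative_def mult.commute[of _ "_ \<bullet> _"])
    from DERIV_pos_inc_right[OF this pos] obtain d where d: "0 < d"
      and inc: "\<And>t. 0 < t \<Longrightarrow> t < d \<Longrightarrow> g z < g (z + t *\<^sub>R (a - z))" by auto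
    define t where "t = min 1 (d / 2)"
    have t: "0 < t" "t < d" "t \<le> 1" using d by (auto simp: t_def)
    have "z + t *\<^sub>R (a - z) \<in> cball a R"
      using convexD_alt[OF convex_cball z, of a t] t R by (simp add: algebra_simps)
    with max inc[OF t(1,2)] show False by fastforce
  qed
  have "(\<lambda>v. G z \<bullet> v) = (\<lambda>v. 0)"
    using zball max by (intro differential_zero_maxmin[OF zball open_ball der]) auto
  from fun_cong[OF this, of "G z"] have zero: "G z = 0" by simp
  have "m * norm (z - a) * norm (z - a) \<le> norm (G a) * norm (z - a)"
    using mono[of z a] z R zero norm_cauchy_schwarz[of "G a" "z - a"]
    by (simp add: power2_eq_square mult.assoc)
  hence "m * norm (z - a) \<le> norm (G a)"
    by (cases "z = a") auto
  hence "norm (z - a) \<le> norm (G a) / m" using m by (simp add: field_simps)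
  with that zball zero max show thesis by blast
qed

text \<open>Expanding the square, one step of size \<open>s\<close> multiplies the squared distance to \<open>z\<close> by at most
  \<open>1 - 2 s m + s\<^sup>2 M\<^sup>2\<close>, which is at most \<open>1 - s m\<close> as \<open>s M\<^sup>2 \<le> m\<close>. In particular the
  iterates never leave the ball on which the estimates hold.\<close>

lemma gradient_ascent_converges:
  fixes x :: "nat \<Rightarrow> 'a::real_inner"
  assumes iter: "\<And>j. x (Suc j) = x j + S (x j) *\<^sub>R G (x j)"
    and start: "norm (x N - z) \<le> \<rho>"
    and mono: "\<And>p. norm (p - z) \<le> \<rho> \<Longrightarrow> G p \<bullet> (p - z) \<le> - m * (norm (p - z))\<^sup>2"
    and growth: "\<And>p. norm (p - z) \<le> \<rho> \<Longrightarrow> norm (G p) \<le> M * norm (p - z)"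
    and step: "\<And>p. norm (p - z) \<le> \<rho> \<Longrightarrow> s0 \<le> S p \<and> S p * M\<^sup>2 \<le> m"
    and s0: "0 < s0" and m: "0 < m"
  shows "x \<longlonglongrightarrow> z"
proof -
  \<comment> \<open>The maximum with 0 makes the powers of \<open>q\<close> nonnegative without a bound on \<open>s0\<close>.\<close>
  define q where "q = max 0 (1 - s0 * m)"
  have q: "0 \<le> q" "q < 1" using s0 m by (auto simp: q_def)
  have contract: "(norm (x (Suc j) - z))\<^sup>2 \<le> q * (norm (x j - z))\<^sup>2" if "norm (x j - z) \<le> \<rho>" for j
  proof -
    let ?p = "x j" let ?s = "S (x j)" let ?n = "(norm (x j - z))\<^sup>2"
    have s: "s0 \<le> ?s" "?s * M\<^sup>2 \<le> m" using step[OF that] by auto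
    have "(norm (x (Suc j) - z))\<^sup>2 = ?n + 2 * ?s * (G ?p \<bullet> (?p - z)) + ?s\<^sup>2 * (norm (G ?p))\<^sup>2"
      unfolding power2_norm_eq_inner iter
      by (simp add: inner_add_left inner_add_right inner_diff_left inner_diff_right inner_commute
          power2_eq_square algebra_simps)
    also have "\<dots> \<le> ?n + 2 * ?s * (- m * ?n) + ?s\<^sup>2 * (M\<^sup>2 * ?n)"
    proof (intro add_mono mult_left_mono order_refl)
      show "G ?p \<bullet> (?p - z) \<le> - m * ?n" using mono[OF that] .
      show "(norm (G ?p))\<^sup>2 \<le> M\<^sup>2 * ?n"
        using power_mono[OF growth[OF that], of 2] by (simp add: power_mult_distrib)
    qed (use s s0 in auto)
    also have "\<dots> = ?n - ?s * ?n * (2 * m - ?s * M\<^sup>2)" by (simp add: power2_eq_square algebra_simps)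
    also have "\<dots> \<le> ?n - s0 * ?n * m"
      using s s0 m by (intro diff_left_mono mult_mono mult_right_mono) auto
    also have "\<dots> = (1 - s0 * m) * ?n" by (simp add: algebra_simps)
    also have "\<dots> \<le> q * ?n" by (intro mult_right_mono) (auto simp: q_def)
    finally show ?thesis .
  qed
  have bound: "norm (x (N + j) - z) \<le> \<rho> \<and> (norm (x (N + j) - z))\<^sup>2 \<le> q ^ j * (norm (x N - z))\<^sup>2" for j
  proof (induction j)
    case 0
    show ?case using start by simp
  next
    case (Suc j)
    have c: "(norm (x (Suc (N + j)) - z))\<^sup>2 \<le> q * (norm (x (N + j) - z))\<^sup>2"
      using Suc by (intro contract) simp
    also have "\<dots> \<le> (norm (x (N + j) - z))\<^sup>2" using q by (intro mult_left_le_one_le) auto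
    finally have "norm (x (Suc (N + j)) - z) \<le> norm (x (N + j) - z)"
      by (rule power2_le_imp_le) simp
    moreover have "q * (norm (x (N + j) - z))\<^sup>2 \<le> q * (q ^ j * (norm (x N - z))\<^sup>2)"
      using Suc q by (intro mult_left_mono) auto
    moreover have "N + Suc j = Suc (N + j)" by simp
    ultimately show ?case
      using Suc.IH c unfolding power_Suc mult.assoc by (metis order_trans)
  qed
  have lim: "(\<lambda>j. q ^ j * (norm (x N - z))\<^sup>2) \<longlonglongrightarrow> 0"
    by (rule tendsto_mult_left_zero[OF LIMSEQ_realpow_zero[OF q]])
  have "norm ((norm (x (N + j) - z))\<^sup>2) \<le> q ^ j * (norm (x N - z))\<^sup>2" for j
    using conjunct2[OF bound[of j]] by simp
  from Lim_null_comparison[OF always_eventually[OF allI[OF this]] lim]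
  have "(\<lambda>j. (norm (x (N + j) - z))\<^sup>2) \<longlonglongrightarrow> 0" .
  from tendsto_real_sqrt[OF this] have "(\<lambda>j. norm (x (N + j) - z)) \<longlonglongrightarrow> 0" by simp
  hence "(\<lambda>j. x (N + j) - z) \<longlonglongrightarrow> 0" by (rule tendsto_norm_zero_cancel)
  hence "(\<lambda>j. x (N + j)) \<longlonglongrightarrow> z" by (rule LIM_zero_cancel)
  hence "(\<lambda>j. x (j + N)) \<longlonglongrightarrow> z" by (simp only: add.commute)
  thus ?thesis by (rule LIMSEQ_offset)
qed

section \<open>Euler steps of variable size along a flow line\<close>

locale flow_line =
  fixes g :: "'a::euclidean_space \<Rightarrow> 'a" and \<gamma> :: "real \<Rightarrow> 'a" and M B :: real
  assumes flow: "\<And>t. 0 \<le> t \<Longrightarrow> (\<gamma> has_vector_derivative g (\<gamma> t)) (at t within {0..})"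
    and lip: "M-lipschitz_on UNIV g"
    and bound: "\<And>x. norm (g x) \<le> B"
begin

lemma M_nonneg: "0 \<le> M" using lip by (rule lipschitz_on_nonneg)

lemma B_nonneg: "0 \<le> B" using bound[of 0] norm_ge_zero order_trans by blast

lemma flow_line_lipschitz:
  assumes "0 \<le> s" "0 \<le> t"
  shows "norm (\<gamma> s - \<gamma> t) \<le> B * \<bar>s - t\<bar>"
proof -
  have "norm (\<gamma> s - \<gamma> t) \<le> B * norm (s - t)"
  proof (rule differentiable_bound[of "{0..}"])
    show "(\<gamma> has_derivative (\<lambda>v. v *\<^sub>R g (\<gamma> u))) (at u within {0..})" if "u \<in> {0..}" for u
      using flow[of u] that by (simp add: has_vector_derivative_def)
    show "onorm (\<lambda>v. v *\<^sub>R g (\<gamma> u)) \<le> B" for u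
      by (rule onorm_le) (use bound in \<open>auto simp: mult.commute[of B] intro: mult_left_mono\<close>)
  qed (use assms in auto)
  thus ?thesis by simp
qed

lemma euler_local_error:
  assumes "0 \<le> t" "0 \<le> s"
  shows "norm (\<gamma> (t + s) - \<gamma> t - s *\<^sub>R g (\<gamma> t)) \<le> M * B * s\<^sup>2"
proof -
  have "norm (\<gamma> (t + s) - \<gamma> t - (t + s - t) *\<^sub>R g (\<gamma> t)) \<le> norm (t + s - t) * (M * (B * s))"
  proof (rule vector_differentiable_bound_linearization[of "{t..t + s}" \<gamma> "\<lambda>u. g (\<gamma> u)"])
    show "(\<gamma> has_vector_derivative g (\<gamma> u)) (at u within {t..t + s})" if "u \<in> {t..t + s}" for u
      using that assms by (intro has_vector_derivative_within_subset[OF flow]) auto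
    show "norm (g (\<gamma> u) - g (\<gamma> t)) \<le> M * (B * s)" if "u \<in> {t..t + s}" for u
    proof -
      have "norm (g (\<gamma> u) - g (\<gamma> t)) \<le> M * norm (\<gamma> u - \<gamma> t)"
        using lipschitz_on_normD[OF lip] by simp
      also have "\<dots> \<le> M * (B * \<bar>u - t\<bar>)"
        using that assms M_nonneg by (intro mult_left_mono flow_line_lipschitz) auto
      also have "\<dots> \<le> M * (B * s)"
        using that M_nonneg B_nonneg by (intro mult_left_mono) auto
      finally show ?thesis .
    qed
  qed (use assms in \<open>auto simp: closed_segment_eq_real_ivl\<close>)
  thus ?thesis using assms by (simp add: power2_eq_square mult_ac)
qed

text \<open>The error grows by the Lipschitz factor of the field, plus the inaccuracy of the
  direction \<open>v\<close>, plus the quadratic local error of the Euler scheme.\<close>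

lemma euler_step_error:
  assumes "0 \<le> t" "0 \<le> s" "s \<le> \<sigma>" and v: "norm (v - g p) \<le> \<eta>"
  shows "norm (p + s *\<^sub>R v - \<gamma> (t + s)) \<le> exp (M * s) * norm (p - \<gamma> t) + s * (\<eta> + M * B * \<sigma>)"
proof -
  let ?e = "norm (p - \<gamma> t)"
  have "p + s *\<^sub>R v - \<gamma> (t + s) = (p - \<gamma> t) + s *\<^sub>R (v - g p) + s *\<^sub>R (g p - g (\<gamma> t))
      - (\<gamma> (t + s) - \<gamma> t - s *\<^sub>R g (\<gamma> t))" by (simp add: algebra_simps)
  also have "norm \<dots> \<le> ?e + norm (s *\<^sub>R (v - g p)) + norm (s *\<^sub>R (g p - g (\<gamma> t)))
      + norm (\<gamma> (t + s) - \<gamma> t - s *\<^sub>R g (\<gamma> t))"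
    by (intro order_trans[OF norm_triangle_ineq4] order_trans[OF norm_triangle_ineq] add_mono
        norm_triangle_ineq order_refl)
  also have "\<dots> \<le> ?e + s * \<eta> + s * (M * ?e) + M * B * s\<^sup>2"
  proof (intro add_mono order_refl)
    show "norm (s *\<^sub>R (v - g p)) \<le> s * \<eta>" using v assms by (simp add: mult_left_mono)
    show "norm (s *\<^sub>R (g p - g (\<gamma> t))) \<le> s * (M * ?e)"
      using lipschitz_on_normD[OF lip, of p "\<gamma> t"] assms by (simp add: mult_left_mono)
  qed (rule euler_local_error[OF assms(1,2)])
  also have "\<dots> \<le> ?e + s * \<eta> + s * (M * ?e) + s * (M * B * \<sigma>)"
  proof -
    have "s * (M * B * s) \<le> s * (M * B * \<sigma>)"
      using assms M_nonneg B_nonneg by (intro mult_left_mono) auto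
    thus ?thesis by (simp add: power2_eq_square mult_ac)
  qed
  also have "\<dots> = (1 + M * s) * ?e + s * (\<eta> + M * B * \<sigma>)" by (simp add: algebra_simps)
  also have "\<dots> \<le> exp (M * s) * ?e + s * (\<eta> + M * B * \<sigma>)"
    by (intro add_right_mono mult_right_mono exp_ge_add_one_self) auto
  finally show ?thesis .
qed

text \<open>Iterate \<open>x n\<close> is compared with the flow line at the elapsed time \<open>\<tau> n\<close>, the sum of the step sizes.
  The step sizes and directions are controlled only near the flow line, so the smallness of
  the error is part of the induction. The lower bound \<open>s0\<close> guarantees that
  the elapsed time passes \<open>T\<close>.\<close>

lemma euler_shadows_flow:
  assumes start: "x 0 = \<gamma> 0"
    and iter: "\<And>j. x (Suc j) = x j + S (x j) *\<^sub>R V (x j)"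
    and near: "\<And>p t. 0 \<le> t \<Longrightarrow> t \<le> T \<Longrightarrow> norm (p - \<gamma> t) \<le> \<delta> \<Longrightarrow>
      s0 \<le> S p \<and> S p \<le> \<sigma> \<and> norm (V p - g p) \<le> \<eta>"
    and s0: "0 < s0" and T: "0 \<le> T" and \<sigma>: "0 \<le> \<sigma>" and \<eta>: "0 \<le> \<eta>"
    and small: "(\<eta> + M * B * \<sigma>) * (T + \<sigma>) * exp (M * (T + \<sigma>)) \<le> \<delta>"
  obtains N t where "T \<le> t" "norm (x N - \<gamma> t) \<le> \<delta>"
proof -
  define \<tau> where "\<tau> n = (\<Sum>j<n. S (x j))" for n
  define \<theta> where "\<theta> = \<eta> + M * B * \<sigma>"
  have \<theta>: "0 \<le> \<theta>" using M_nonneg B_nonneg \<sigma> \<eta> by (simp add: \<theta>_def)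
  have err: "real n * s0 \<le> \<tau> n \<and> \<tau> n \<le> T + \<sigma> \<and>
      norm (x n - \<gamma> (\<tau> n)) \<le> \<theta> * \<tau> n * exp (M * \<tau> n) \<and> norm (x n - \<gamma> (\<tau> n)) \<le> \<delta>"
    if "\<And>j. j < n \<Longrightarrow> \<tau> j \<le> T" for n
    using that
  proof (induction n)
    case 0
    have "0 \<le> \<theta> * (T + \<sigma>) * exp (M * (T + \<sigma>))" using \<theta> T \<sigma> by simp
    with small have "0 \<le> \<delta>" by (simp add: \<theta>_def)
    thus ?case using T \<sigma> start by (simp add: \<tau>_def)
  next
    case (Suc n)
    hence IH: "real n * s0 \<le> \<tau> n" "norm (x n - \<gamma> (\<tau> n)) \<le> \<theta> * \<tau> n * exp (M * \<tau> n)"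
      "norm (x n - \<gamma> (\<tau> n)) \<le> \<delta>" and \<tau>T: "\<tau> n \<le> T" by auto
    have \<tau>0: "0 \<le> \<tau> n" using IH(1) s0 by (meson mult_nonneg_nonneg of_nat_0_le_iff order_trans less_imp_le)
    let ?s = "S (x n)"
    have s: "s0 \<le> ?s" "?s \<le> \<sigma>" "norm (V (x n) - g (x n)) \<le> \<eta>"
      using near[OF \<tau>0 \<tau>T IH(3)] by auto
    have \<tau>S: "\<tau> (Suc n) = \<tau> n + ?s" by (simp add: \<tau>_def)
    have "norm (x (Suc n) - \<gamma> (\<tau> (Suc n))) \<le> exp (M * ?s) * norm (x n - \<gamma> (\<tau> n)) + ?s * \<theta>"
      unfolding iter \<tau>S \<theta>_def using s s0 \<tau>0 by (intro euler_step_error) auto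
    also have "\<dots> \<le> exp (M * ?s) * (\<theta> * \<tau> n * exp (M * \<tau> n)) + ?s * \<theta> * exp (M * (\<tau> n + ?s))"
    proof (intro add_mono mult_left_mono)
      have "?s * \<theta> * 1 \<le> ?s * \<theta> * exp (M * (\<tau> n + ?s))"
        using s s0 \<theta> \<tau>0 M_nonneg by (intro mult_left_mono) auto
      thus "?s * \<theta> \<le> ?s * \<theta> * exp (M * (\<tau> n + ?s))" by simp
    qed (use IH(2) in auto)
    also have "\<dots> = \<theta> * \<tau> (Suc n) * exp (M * \<tau> (Suc n))"
      unfolding \<tau>S distrib_left exp_add by (simp add: algebra_simps)
    finally have e: "norm (x (Suc n) - \<gamma> (\<tau> (Suc n))) \<le> \<theta> * \<tau> (Suc n) * exp (M * \<tau> (Suc n))" .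
    have le: "\<tau> (Suc n) \<le> T + \<sigma>" using \<tau>S \<tau>T s by simp
    have "\<theta> * \<tau> (Suc n) * exp (M * \<tau> (Suc n)) \<le> \<theta> * (T + \<sigma>) * exp (M * (T + \<sigma>))"
      using \<theta> le T \<sigma> M_nonneg by (intro mult_mono mult_left_mono) (auto intro: mult_left_mono)
    with e small have "norm (x (Suc n) - \<gamma> (\<tau> (Suc n))) \<le> \<delta>" by (simp add: \<theta>_def)
    moreover have "real (Suc n) * s0 \<le> \<tau> (Suc n)"
      using IH(1) s \<tau>S by (simp add: algebra_simps)
    ultimately show ?case using e le by blast
  qed
  have "\<exists>n. T < \<tau> n"
  proof (rule ccontr)
    assume "\<not> (\<exists>n. T < \<tau> n)"
    hence "real n * s0 \<le> T + \<sigma>" for n using err[of n] by (force simp: not_less)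
    moreover obtain n where "T + \<sigma> < real n * s0" using reals_Archimedean3[OF s0] by blast
    ultimately show False by (simp add: not_less[symmetric])
  qed
  then obtain N where N: "T < \<tau> N" "\<And>j. j < N \<Longrightarrow> \<tau> j \<le> T"
    using exists_least_iff[of "\<lambda>n. T < \<tau> n"] by (auto simp: not_less)
  have "norm (x N - \<gamma> (\<tau> N)) \<le> \<delta>" using err N(2) by blast
  with N(1) show thesis by (intro that[of "\<tau> N" N]) auto
qed

end

lemma gradient_flow_nondecreasing:
  fixes f :: "'a::euclidean_space \<Rightarrow> real"
  assumes der: "\<And>x. (f has_derivative (\<lambda>v. G x \<bullet> v)) (at x)"
    and flow: "\<And>t. 0 \<le> t \<Longrightarrow> (\<gamma> has_vector_derivative G (\<gamma> t)) (at t within {0..})"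
    and t: "0 \<le> t"
  shows "f (\<gamma> 0) \<le> f (\<gamma> t)"
proof (rule DERIV_nonneg_imp_increasing_open[OF t])
  fix u :: real assume u: "0 < u" "u < t"
  have "(\<gamma> has_vector_derivative G (\<gamma> u)) (at u within {0<..})"
    using u by (intro has_vector_derivative_within_subset[OF flow]) auto
  hence "(\<gamma> has_vector_derivative G (\<gamma> u)) (at u)"
    using at_within_open[of u "{0<..}"] u by simp
  from diff_chain_at[OF this[unfolded has_vector_derivative_def] der]
  have "((\<lambda>u. f (\<gamma> u)) has_real_derivative G (\<gamma> u) \<bullet> G (\<gamma> u)) (at u)"
    by (simp add: has_field_derivative_def o_def mult.commute[of _ "_ \<bullet> _"])
  thus "\<exists>y. ((\<lambda>u. f (\<gamma> u)) has_real_derivative y) (at u) \<and> 0 \<le> y"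
    using inner_ge_zero by blast
next
  have "continuous_on {0..} \<gamma>"
    unfolding continuous_on_eq_continuous_within
    by (intro ballI has_vector_derivative_continuous[OF flow]) auto
  hence "continuous_on {0..t} \<gamma>" by (rule continuous_on_subset) auto
  moreover have "continuous_on UNIV f"
    using der by (meson continuous_at_imp_continuous_on has_derivative_continuous)
  ultimately show "continuous_on {0..t} (\<lambda>u. f (\<gamma> u))"
    using continuous_on_compose2[of UNIV f "{0..t}" \<gamma>] by simp
qed

section \<open>Consistency of Mean Shift\<close>

context shadow_kernel
begin

text \<open>Each smallness condition needed to combine shadowing and local contraction holds for all small \<open>h\<close>
  because the spreads of both kernels and the step bound \<open>h\<^sup>2 / (c f(x0))\<close> tend to 0. The
  distance bound for \<open>z\<close> comes from strong monotonicity and yields \<open>z \<rightarrow> xs\<close>.\<close>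

lemma mean_shift_converges:
  fixes f :: "real^'n \<Rightarrow> real" and xs x0 :: "real^'n"
  assumes f_nonneg: "\<And>x. 0 \<le> f x"
    and f_bound: "\<And>x. \<bar>f x\<bar> \<le> A"
    and f_diff: "\<And>x. f differentiable (at x)"
    and g_bound: "\<And>x. norm (grad f x) \<le> B"
    and g_lip: "M-lipschitz_on UNIV (grad f)" and M: "0 < M"
    and m: "0 < m" and r: "0 < r"
    and g_mono: "\<And>x y. x \<in> ball xs r \<Longrightarrow> y \<in> ball xs r \<Longrightarrow>
      (grad f x - grad f y) \<bullet> (x - y) \<le> - m * (norm (x - y))\<^sup>2"
    and g_zero: "grad f xs = 0"
    and trajectory: "is_gradient_flow_line f x0 \<gamma>" and lim: "(\<gamma> \<longlongrightarrow> xs) at_top"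
    and x0_pos: "0 < f x0"
  shows "\<forall>\<^sub>F h in at_right 0. \<exists>z. is_mode (convolve (rescale h L) f) z \<and>
    norm (z - xs) \<le> 2 / m * ((2 * B + M) * spread L h) \<and> mean_shift_seq K f h x0 \<longlonglongrightarrow> z"
proof -
  have f_der: "(f has_derivative (\<lambda>v. grad f x \<bullet> v)) (at x)" for x
    using f_diff by (rule has_derivative_grad)
  have f_lip: "B-lipschitz_on UNIV f"
    using f_diff g_bound by (rule lipschitz_from_bounded_grad)
  have f_cont: "continuous_on UNIV f" using f_lip by (rule lipschitz_on_continuous_on)
  have g_cont: "continuous_on UNIV (grad f)" using g_lip by (rule lipschitz_on_continuous_on)
  have f_bound': "norm (f x) \<le> A" for x using f_bound by simp
  have fm: "f \<in> borel_measurable borel" using f_cont by (rule borel_measurable_continuous_onI)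
  have B: "0 \<le> B" using f_lip by (rule lipschitz_on_nonneg)
  interpret flow_line "grad f" \<gamma> M B
    using trajectory g_lip g_bound by unfold_locales (auto simp: is_gradient_flow_line_def)
  define a where "a = f x0"
  have a: "0 < a" using x0_pos by (simp add: a_def)
  have A: "0 < A" using f_bound[of x0] x0_pos by linarith
  have \<gamma>0: "\<gamma> 0 = x0" using trajectory by (simp add: is_gradient_flow_line_def)
  have f_\<gamma>: "a \<le> f (\<gamma> t)" if "0 \<le> t" for t
    using gradient_flow_nondecreasing[OF f_der flow that] \<gamma>0
    by (simp add: a_def)
  have f_xs: "a \<le> f xs"
  proof (rule tendsto_lowerbound)
    have "isCont f xs" using f_der has_derivative_continuous by blast
    thus "((\<lambda>t. f (\<gamma> t)) \<longlongrightarrow> f xs) at_top" using lim by (rule isCont_tendsto_compose)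
    show "\<forall>\<^sub>F t in at_top. a \<le> f (\<gamma> t)"
      using eventually_ge_at_top[of 0] by (rule eventually_mono) (rule f_\<gamma>)
  qed simp
  \<comment> \<open>Within distance \<open>R\<close> the function \<open>f\<close> changes by at most \<open>a / 4\<close>, and the ball of radius \<open>2 R\<close> lies in
    the region of strong monotonicity.\<close>
  define R where "R = min 1 (min (r / 3) (a / (4 * (B + 1))))"
  have "0 < R" using r a B by (simp add: R_def)
  moreover have "R \<le> 1" "R \<le> r / 3" unfolding R_def by linarith+
  ultimately have R: "0 < R" "R \<le> 1" "2 * R < r" using r by auto
  \<comment> \<open>Shadowing error and remaining distance of the flow line are at most \<open>R / 8\<close> each; the mode of
    the average is within \<open>R / 8\<close> too, which leaves the ball of radius \<open>R / 2\<close> around it for the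
    local iteration.\<close>
  define \<delta> where "\<delta> = R / 8"
  have \<delta>: "0 < \<delta>" using R by (simp add: \<delta>_def)
  have f_close: "3 / 4 * a \<le> f p" if "a \<le> f y" "norm (p - y) \<le> R" for p y
  proof -
    have "\<bar>f p - f y\<bar> \<le> B * norm (p - y)" using lipschitz_on_normD[OF f_lip, of p y] by simp
    also have "\<dots> \<le> (B + 1) * (a / (4 * (B + 1)))"
      using that B by (intro mult_mono) (auto simp: R_def)
    also have "\<dots> = a / 4" using B by (simp add: field_simps)
    finally show ?thesis using that by linarith
  qed
  obtain T where T: "0 \<le> T" and \<gamma>_near: "\<And>t. T \<le> t \<Longrightarrow> norm (\<gamma> t - xs) \<le> \<delta>"
  proof -
    from tendstoD[OF lim \<delta>] obtain T where "\<And>t. T \<le> t \<Longrightarrow> dist (\<gamma> t) xs < \<delta>"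
      by (auto simp: eventually_at_top_linorder)
    thus thesis by (intro that[of "max 0 T"]) (auto simp: dist_norm less_imp_le)
  qed
  define \<sigma> where "\<sigma> h = h\<^sup>2 / (c * a)" for h
  define \<eta> where "\<eta> h = (2 * B + M) * spread L h" for h
  have \<sigma>0: "(\<sigma> \<longlongrightarrow> 0) (at_right 0)"
  proof -
    have "(\<sigma> \<longlongrightarrow> 0\<^sup>2 / (c * a)) (at_right 0)"
      unfolding \<sigma>_def using a c_pos by (intro tendsto_intros) auto
    thus ?thesis by simp
  qed
  have \<eta>0: "(\<eta> \<longlongrightarrow> 0) (at_right 0)"
    unfolding \<eta>_def by (rule tendsto_mult_right_zero[OF L.spread_tendsto_0])
  have "((\<lambda>h. (\<eta> h + M * B * \<sigma> h) * (T + \<sigma> h) * exp (M * (T + \<sigma> h)))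
      \<longlongrightarrow> (0 + M * B * 0) * (T + 0) * exp (M * (T + 0))) (at_right 0)"
    by (intro tendsto_intros \<sigma>0 \<eta>0)
  hence ev1: "\<forall>\<^sub>F h in at_right 0. (\<eta> h + M * B * \<sigma> h) * (T + \<sigma> h) * exp (M * (T + \<sigma> h)) < \<delta>"
    by (intro order_tendstoD(2)[OF _ \<delta>]) simp
  have ev2: "\<forall>\<^sub>F h in at_right 0. (2 * A + B) * spread K h < a / 4"
    using a by (intro order_tendstoD(2)[OF tendsto_mult_right_zero[OF K.spread_tendsto_0]]) auto
  have ev3: "\<forall>\<^sub>F h in at_right 0. (M + m) / R * spread L h < m / 2"
    using m by (intro order_tendstoD(2)[OF tendsto_mult_right_zero[OF L.spread_tendsto_0]]) auto
  have ev4: "\<forall>\<^sub>F h in at_right 0. \<sigma> h * M\<^sup>2 < m / 2"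
    using m by (intro order_tendstoD(2)[OF tendsto_mult_left_zero[OF \<sigma>0]]) auto
  have ev5: "\<forall>\<^sub>F h in at_right 0. 2 / m * \<eta> h < \<delta>"
    using \<delta> by (intro order_tendstoD(2)[OF tendsto_mult_right_zero[OF \<eta>0]]) auto
  from ev1 ev2 ev3 ev4 ev5 eventually_at_right_less[of 0] show ?thesis
  proof eventually_elim
    case (elim h)
    let ?G = "kernel_avg L h (grad f)" and ?p = "kernel_avg K h f"
    \<comment> \<open>\<open>S p\<close> is the step size at \<open>p\<close>. It lies between \<open>h\<^sup>2 / (2 c A)\<close> and \<open>\<sigma> h\<close> where
      \<open>f p \<ge> 3 a / 4\<close>, since then \<open>p\<^sub>h\<close> is between \<open>a / 2\<close> and \<open>A\<close>.\<close>
    define S where "S p = h\<^sup>2 / (2 * c * ?p p)" for p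
    have h: "0 < h" "0 \<le> h" using elim(6) by auto
    have \<sigma>_pos: "0 \<le> \<sigma> h" using a c_pos by (simp add: \<sigma>_def)
    have approx: "\<bar>f (x + w) - f x - grad f x \<bullet> w\<bar> \<le> M * (norm w)\<^sup>2" for x w
      by (rule gradient_linear_approx[OF f_der g_lip])
    have iter: "mean_shift_seq K f h x0 (Suc j) = mean_shift_seq K f h x0 j +
        S (mean_shift_seq K f h x0 j) *\<^sub>R ?G (mean_shift_seq K f h x0 j)" for j
      using mean_shift_is_gradient_step[OF f_cont f_bound f_nonneg h(1) g_cont g_bound approx]
      by (simp add: S_def)
    have G_close: "norm (?G x - grad f x) \<le> \<eta> h" for x
      unfolding \<eta>_def by (rule L.kernel_avg_approx[OF g_lip g_bound h(2)])
    have \<eta>_nonneg: "0 \<le> \<eta> h" using G_close[of 0] norm_ge_zero order_trans by blast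
    have S_bounds: "h\<^sup>2 / (2 * c * A) \<le> S p \<and> S p \<le> \<sigma> h" if p: "3 / 4 * a \<le> f p" for p
    proof -
      have "\<bar>?p p - f p\<bar> \<le> a / 4"
        using K.kernel_avg_approx[OF f_lip f_bound' h(2), of p] elim(2) by simp
      hence lo: "a / 2 \<le> ?p p" using p by linarith
      have hi: "?p p \<le> A" using K.norm_kernel_avg_le[OF f_cont f_bound', of h p] by simp
      have "h\<^sup>2 / (2 * c * A) \<le> S p"
        unfolding S_def using lo hi a c_pos by (intro divide_left_mono mult_left_mono) auto
      moreover have "S p \<le> h\<^sup>2 / (2 * c * (a / 2))"
        unfolding S_def using lo a c_pos by (intro divide_left_mono mult_left_mono) auto
      ultimately show ?thesis by (simp add: \<sigma>_def)
    qed
    have s0: "0 < h\<^sup>2 / (2 * c * A)" using h A c_pos by simp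
    obtain N t where "T \<le> t" and N: "norm (mean_shift_seq K f h x0 N - \<gamma> t) \<le> \<delta>"
    proof (rule euler_shadows_flow[of "mean_shift_seq K f h x0" S ?G T \<delta> "h\<^sup>2 / (2 * c * A)" "\<sigma> h" "\<eta> h"])
      show "mean_shift_seq K f h x0 0 = \<gamma> 0" using \<gamma>0 by simp
      show "h\<^sup>2 / (2 * c * A) \<le> S p \<and> S p \<le> \<sigma> h \<and> norm (?G p - grad f p) \<le> \<eta> h"
        if "0 \<le> t" "norm (p - \<gamma> t) \<le> \<delta>" for p t
        using S_bounds[OF f_close[OF f_\<gamma>[OF that(1)], of p]] that(2) G_close[of p] R
        by (simp add: \<delta>_def)
    qed (use iter s0 T \<sigma>_pos \<eta>_nonneg elim(1) in auto)
    have near_xs: "norm (mean_shift_seq K f h x0 N - xs) \<le> R / 4"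
      using norm_triangle_ineq[of "mean_shift_seq K f h x0 N - \<gamma> t" "\<gamma> t - xs"] N \<gamma>_near[OF \<open>T \<le> t\<close>]
      by (simp add: \<delta>_def)
    have G_mono: "(?G x - ?G y) \<bullet> (x - y) \<le> - (m / 2) * (norm (x - y))\<^sup>2"
      if "x \<in> cball xs R" "y \<in> cball xs R" for x y
    proof -
      have "(?G x - ?G y) \<bullet> (x - y) \<le> - (m - (M + m) * spread L h / R) * (norm (x - y))\<^sup>2"
        using m that R h by (intro L.kernel_avg_strongly_monotone[OF g_lip g_bound g_mono]) auto
      also have "\<dots> \<le> - (m / 2) * (norm (x - y))\<^sup>2"
      proof (rule mult_right_mono)
        have "(M + m) * spread L h / R < m / 2" using elim(3) by (simp only: times_divide_eq_left)
        thus "- (m - (M + m) * spread L h / R) \<le> - (m / 2)" by linarith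
      qed simp
      finally show ?thesis .
    qed
    have G_xs: "norm (?G xs) \<le> \<eta> h" using G_close[of xs] g_zero by simp
    have "\<eta> h < m / 2 * \<delta>" using elim(5) m by (simp add: field_simps)
    also have "\<dots> \<le> m / 2 * R" using m R by (intro mult_left_mono) (auto simp: \<delta>_def)
    finally have G_small: "norm (?G xs) < m / 2 * R" using G_xs by simp
    have G_der: "(kernel_avg L h f has_derivative (\<lambda>v. ?G x \<bullet> v)) (at x)" for x
      by (rule has_derivative_from_linear_approx,
          rule L.kernel_avg_linear_approx[OF f_cont f_bound' g_cont g_bound approx])
    obtain z where z: "z \<in> ball xs R" "?G z = 0"
      and z_max: "\<And>y. y \<in> cball xs R \<Longrightarrow> kernel_avg L h f y \<le> kernel_avg L h f z"
      and z_near: "norm (z - xs) \<le> norm (?G xs) / (m / 2)"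
      using interior_max_of_strongly_monotone_gradient[OF G_der G_mono R(1) _ G_small] m by auto
    have "norm (z - xs) \<le> \<eta> h / (m / 2)"
      using z_near divide_right_mono[OF G_xs, of "m / 2"] m by linarith
    hence z_close: "norm (z - xs) \<le> 2 / m * \<eta> h" by (simp add: mult.commute)
    have z4: "norm (z - xs) \<le> R / 4" using z_close elim(5) R by (simp add: \<delta>_def)
    have "\<forall>\<^sub>F y in nhds z. y \<in> ball xs R"
      using z(1) by (intro eventually_nhds_in_open) auto
    hence "is_mode (convolve (rescale h L) f) z"
      unfolding is_mode_def convolve_eq_kernel_avg[OF fm h(1)]
      by (rule eventually_mono) (use z_max in auto)
    moreover have "mean_shift_seq K f h x0 \<longlonglongrightarrow> z"
    proof (rule gradient_ascent_converges[where x="mean_shift_seq K f h x0" and S=S and G="?G" and \<rho>="R / 2" and m="m / 2"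
          and M=M and N=N, OF iter])
      have in_cball: "p \<in> cball xs R" if "norm (p - z) \<le> R / 2" for p
      proof -
        have "norm (p - xs) \<le> R"
          using norm_triangle_ineq[of "p - z" "z - xs"] that z4 R by simp
        thus ?thesis by (simp add: dist_norm norm_minus_commute)
      qed
      show "norm (mean_shift_seq K f h x0 N - z) \<le> R / 2"
        using norm_triangle_ineq4[of "mean_shift_seq K f h x0 N - xs" "z - xs"] near_xs z4 by simp
      show "?G p \<bullet> (p - z) \<le> - (m / 2) * (norm (p - z))\<^sup>2" if "norm (p - z) \<le> R / 2" for p
        using G_mono[OF in_cball[OF that], of z] z by simp
      show "norm (?G p) \<le> M * norm (p - z)" for p
        using lipschitz_on_normD[OF L.kernel_avg_lipschitz[OF g_lip g_bound], of p z h] z(2) by simp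
      show "h\<^sup>2 / (2 * c * A) \<le> S p \<and> S p * M\<^sup>2 \<le> m / 2" if "norm (p - z) \<le> R / 2" for p
      proof -
        have "norm (p - xs) \<le> R" using in_cball[OF that] by (simp add: dist_norm norm_minus_commute)
        from S_bounds[OF f_close[OF f_xs this]] have S: "h\<^sup>2 / (2 * c * A) \<le> S p" "S p \<le> \<sigma> h" by auto
        moreover have "S p * M\<^sup>2 \<le> \<sigma> h * M\<^sup>2" using S by (intro mult_right_mono) auto
        ultimately show ?thesis using elim(4) by simp
      qed
    qed (use s0 m in auto)
    ultimately show ?case using z_close unfolding \<eta>_def by blast
  qed
qed

end



theorem mainTheorem7:
  fixes f :: "real^'n \<Rightarrow> real"
    and k :: "real \<Rightarrow> real" and c :: real
    and K L :: "real^'n \<Rightarrow> real"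
    and xs x0 :: "real^'n"
  assumes f_nonneg: "\<And>x. 0 \<le> f x"
    and f_density: "has_bochner_integral lborel f 1"
    and f_vanish: "(f \<longlongrightarrow> 0) at_infinity"
    and f_diff: "\<And>x. f differentiable (at x)"
    and grad_diff: "\<And>x. grad f differentiable (at x)"
    and f_bounded: "bounded (range f)"
    and grad_bounded: "bounded (range (grad f))"
    and hess_bounded: "bounded (range (hess f))"
    and f_ucont: "uniformly_continuous_on UNIV f"
    and grad_ucont: "uniformly_continuous_on UNIV (grad f)"
    and hess_ucont: "uniformly_continuous_on UNIV (hess f)"
    and morse: "\<And>x. grad f x = 0 \<Longrightarrow> invertible (hess f x)"
    and k_nonneg: "\<And>u. 0 \<le> u \<Longrightarrow> 0 \<le> k u"
    and k_antimono: "antimono_on {0..} k"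
    and k_integrable: "set_integrable lborel {0..} k"
    and K_def: "K = radial k"
    and K_kernel: "has_bochner_integral lborel K 1"
    and c_pos: "0 < c"
    and L_def: "L = radial (shadow_profile k c)"
    and L_kernel: "has_bochner_integral lborel L 1"
    and mode: "is_mode f xs"
    and x0_pos: "0 < f x0"
    and x0_basin: "x0 \<in> basin f xs"
  shows "\<exists>h0>0. \<exists>xh :: real \<Rightarrow> real^'n.
           (\<forall>h\<in>{0<..h0}. is_mode (convolve (rescale h L) f) (xh h)) \<and>
           (xh \<longlongrightarrow> xs) (at_right 0) \<and>
           (\<forall>h\<in>{0<..h0}. mean_shift_seq K f h x0 \<longlonglongrightarrow> xh h)"
proof -
  interpret shadow_kernel k c K L
    by unfold_locales (fact k_nonneg k_antimono k_integrable K_def K_kernel c_pos L_def L_kernel)+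
  obtain A where A: "\<And>x. \<bar>f x\<bar> \<le> A"
    using f_bounded unfolding bounded_iff by auto
  obtain B where B: "\<And>x. norm (grad f x) \<le> B"
    using grad_bounded unfolding bounded_iff by auto
  obtain M where M: "0 < M" "M-lipschitz_on UNIV (grad f)"
    using grad_diff hess_bounded by (rule lipschitz_grad)
  have crit: "grad f xs = 0"
    using mode unfolding is_mode_def
    by (rule second_order_necessary(1)[OF has_derivative_grad[OF f_diff] has_derivative_hess[OF grad_diff]])
  have "continuous (at xs) (hess f)"
    using uniformly_continuous_imp_continuous[OF hess_ucont] by (simp add: continuous_on_eq_continuous_at)
  then obtain m r where mr: "0 < m" "0 < r"
    "\<And>x y. x \<in> ball xs r \<Longrightarrow> y \<in> ball xs r \<Longrightarrow>
      (grad f x - grad f y) \<bullet> (x - y) \<le> - m * (norm (x - y))\<^sup>2"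
    using grad_strongly_monotone_near_mode[OF f_diff grad_diff _ morse[OF crit] mode] by metis
  obtain \<gamma> where \<gamma>: "is_gradient_flow_line f x0 \<gamma>" "(\<gamma> \<longlongrightarrow> xs) at_top"
    using x0_basin by (auto simp: basin_def)
  define e where "e h = 2 / m * ((2 * B + M) * spread L h)" for h
  have e0: "(e \<longlongrightarrow> 0) (at_right 0)"
    unfolding e_def by (intro tendsto_mult_right_zero L.spread_tendsto_0)
  have "\<forall>\<^sub>F h in at_right 0. \<exists>z. is_mode (convolve (rescale h L) f) z \<and>
      norm (z - xs) \<le> e h \<and> mean_shift_seq K f h x0 \<longlonglongrightarrow> z"
    unfolding e_def
    by (rule mean_shift_converges[OF f_nonneg A f_diff B M(2,1) mr crit \<gamma> x0_pos])
  then obtain b where b: "0 < b" and ex: "\<And>h. 0 < h \<Longrightarrow> h < b \<Longrightarrow> \<exists>z. is_mode (convolve (rescale h L) f) z \<and>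
      norm (z - xs) \<le> e h \<and> mean_shift_seq K f h x0 \<longlonglongrightarrow> z"
    unfolding eventually_at_right_field by blast
  then obtain xh where xh: "\<And>h. 0 < h \<Longrightarrow> h < b \<Longrightarrow> is_mode (convolve (rescale h L) f) (xh h) \<and>
      norm (xh h - xs) \<le> e h \<and> mean_shift_seq K f h x0 \<longlonglongrightarrow> xh h"
    by metis
  have "\<forall>\<^sub>F h in at_right 0. norm (xh h - xs) \<le> e h"
    unfolding eventually_at_right_field using b xh by blast
  from LIM_zero_cancel[OF Lim_null_comparison[OF this e0]] have "(xh \<longlongrightarrow> xs) (at_right 0)" .
  with b xh show ?thesis by (intro exI[of _ "b / 2"] conjI exI[of _ xh]) auto
qed

end
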